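(* Let $r,s\in\mathbb N$ and let $\boldsymbol{\alpha}=\{\alpha_k\}_{k=1}^r$ and $\boldsymbol{\beta}=\{\beta_\ell\}_{\ell=1}^s$ be sequences of positive real numbers with $\sum_{k=1}^r \alpha_k < \sum_{\ell=1}^s \beta_\ell$. Let $\{\mu_k\}_{k=1}^r, \{\nu_\ell\}_{\ell=1}^s \subset \mathbb N_0$, where $\mu_1 < \mu_2 < \cdots < \mu_r$ and $\nu_1 < \nu_2 < \cdots < \nu_s$. Then for any $m\in\mathbb N$, there exists an $N$ (depending on $\boldsymbol{\alpha},\boldsymbol{\beta},\mu_r$ and $m$) such that for all integers $n>N$, $$\sum_{k=1}^r \alpha_k\, \rho(n+\mu_k,m) \leq \sum_{\ell=1}^s \beta_\ell\, \rho(n+\nu_\ell,m).$$ Specifically, for any choice of real $A,B,C>0$ with $\frac1A+\frac1B+\frac1C<1$, we may take $N=N_{\boldsymbol{\alpha},\boldsymbol{\beta},\mu_r+m(m-1)/2}:=N_{A,B,C}(\varepsilon,L)$ with $L:=\mu_r+m(m-1)/2$ and $\varepsilon:=\left(\sum_{k=1}^r\alpha_k\right)^{-1}\left(\sum_{\ell=1}^s\beta_\ell-\sum_{k=1}^r\alpha_k\right)$.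
   Context: $\mathbb N=\{1,2,\dots\}$ and $\mathbb N_0=\{0,1,2,\dots\}$. $\rho(n,m)$ denotes the number of partitions of $n$ into distinct parts, all at least $m$. For real $A,B,C>0$ with $D:=\frac1A+\frac1B+\frac1C<1$, real $\varepsilon>0$ and integer $L\ge 0$, define $$N_{A,B,C}(\varepsilon,L):=\max(N_A,N_B,N_C,N_D,26),$$ where $$N_A=\frac{12A^2(2+\varepsilon)^2}{\pi^2\varepsilon^2}-L-\frac1{24},\qquad N_B=\frac{910787328\,B^4(2+\varepsilon)^4}{10000\,\pi^8\varepsilon^4}-L-\frac1{24},$$ $$N_C=\frac{3}{4\pi^2}\log^2\!\left(\frac{2C(2+\varepsilon)(1+L)}{\varepsilon}\right)-\frac1{24},\qquad N_D=\frac{L^2\pi^2}{12\log^2\!\left(\frac{1+\varepsilon}{1+\varepsilon D}\right)}-\frac1{24},$$ and $\log$ is the natural logarithm ($\log^2(x)=(\log x)^2$). *)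

theory Defs
  imports "HOL-Analysis.Analysis"
begin

text \<open>A partition into distinct parts is identified with the finite set of its (positive) parts.\<close>

definition distinct_partitions :: "nat \<Rightarrow> nat \<Rightarrow> nat set set" where
  "distinct_partitions n m = {S. finite S \<and> (\<forall>k\<in>S. 0 < k \<and> m \<le> k) \<and> \<Sum>S = n}"

definition rho :: "nat \<Rightarrow> nat \<Rightarrow> nat" where
  "rho n m = card (distinct_partitions n m)"

text \<open>\<^const>\<open>card\<close> is 0 on infinite sets, so \<^const>\<open>rho\<close> is a genuine count only because of
  the following fact.\<close>

lemma finite_distinct_partitions: "finite (distinct_partitions n m)"
proof (rule finite_subset)
  show "distinct_partitions n m \<subseteq> Pow {..n}"
    by (auto simp: distinct_partitions_def intro: member_le_sum[where f = "\<lambda>x. x", simplified])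
qed simp

definition N_A :: "real \<Rightarrow> real \<Rightarrow> nat \<Rightarrow> real" where
  "N_A A \<epsilon> L = 12 * A^2 * (2 + \<epsilon>)^2 / (pi^2 * \<epsilon>^2) - real L - 1/24"

definition N_B :: "real \<Rightarrow> real \<Rightarrow> nat \<Rightarrow> real" where
  "N_B B \<epsilon> L = 910787328 * B^4 * (2 + \<epsilon>)^4 / (10000 * pi^8 * \<epsilon>^4) - real L - 1/24"

definition N_C :: "real \<Rightarrow> real \<Rightarrow> nat \<Rightarrow> real" where
  "N_C C \<epsilon> L = 3 / (4 * pi^2) * (ln (2 * C * (2 + \<epsilon>) * (1 + real L) / \<epsilon>))^2 - 1/24"

definition N_D :: "real \<Rightarrow> real \<Rightarrow> nat \<Rightarrow> real" where
  "N_D D \<epsilon> L = (real L)^2 * pi^2 / (12 * (ln ((1 + \<epsilon>) / (1 + \<epsilon> * D)))^2) - 1/24"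

definition N_ABC :: "real \<Rightarrow> real \<Rightarrow> real \<Rightarrow> real \<Rightarrow> nat \<Rightarrow> real" where
  "N_ABC A B C \<epsilon> L =
     Max {N_A A \<epsilon> L, N_B B \<epsilon> L, N_C C \<epsilon> L, N_D (1/A + 1/B + 1/C) \<epsilon> L, 26}"

end

theory Submission
  imports Defs
begin

text \<open>
Write \<open>q(n) = \<rho>(n,1)\<close> and \<open>\<gamma> = \<pi>/\<surd>12\<close>.  The claim comes down to one growth estimate for \<open>q\<close>, which is
proved by elementary means, without the circle method.

\<^bold>\<open>Reduction to one shift of q.\<close>  Since \<open>\<rho>(\<cdot>,m)\<close> is nondecreasing on positive arguments, all shifts
\<open>\<mu>\<^sub>k\<close> may be replaced by \<open>\<mu>\<^sub>r\<close> and all \<open>\<nu>\<^sub>l\<close> by \<open>0\<close>, so it suffices to show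
\<open>\<rho>(n+\<mu>,m) \<le> (1+\<epsilon>) \<rho>(n,m)\<close>.  Splitting by whether \<open>m\<close> is a part gives
\<open>\<rho>(n,m) = \<rho>(n,m+1) + \<rho>(n-m,m+1)\<close>, and with monotonicity a growth bound for shift \<open>\<mu>+m\<close> and least part
\<open>m\<close> yields the same bound for shift \<open>\<mu>\<close> and least part \<open>m+1\<close>.  Iterating from \<open>1\<close> to \<open>m\<close> costs the
total shift \<open>m(m-1)/2\<close>; this is where \<open>L = \<mu> + m(m-1)/2\<close> comes from
(\<open>growth_bound_all_min_parts\<close>).

\<^bold>\<open>A discrete Bessel equation.\<close>  Counting parts gives
\<open>n q(n) = \<Sum>\<^sub>i \<Sum>\<^sub>j (-1)^i j q(n-(i+1)j)\<close>.  Summation by parts turns the irregular divisor sums into their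
summatory function \<open>kernel k = \<gamma>\<^sup>2 k\<^sup>2/2 + O(k log k)\<close>, integrated against the nonnegative
differences of \<open>q\<close>.  With the iterated partial sums \<open>q1\<close>, \<open>q2\<close> of \<open>q\<close> this says
\<open>n q(n) = \<gamma>\<^sup>2 q2(n-1)\<close> up to a relative error of order \<open>n^(-1/2) log n\<close>
(\<open>q_upper\<close>, \<open>q_lower\<close>).  As \<open>q\<close> is the second difference of \<open>q2\<close>, this is a discrete form of
\<open>u'' = \<gamma>\<^sup>2 u / n\<close>.

\<^bold>\<open>Riccati comparison.\<close>  The ratio \<open>q1(n)/q2(n-1)\<close> then obeys a discrete Riccati equation, for which
\<open>\<gamma> n^(-1/2) + n^(-3/4)\<close> is a supersolution from \<open>n = 26\<close> on
(\<open>partial_sum_ratio\<close>).  Multiplying the ratios up bounds \<open>q2(n+L)/q2(n)\<close> by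
\<open>exp(\<gamma> L/\<surd>n)\<close> times a small correction, and the two-sided comparison of \<open>n q(n)\<close> with \<open>q2(n-1)\<close>
transfers this to \<open>q\<close>.

\<^bold>\<open>Matching the thresholds.\<close>  Put \<open>x = \<gamma> L/\<surd>(n+1/24)\<close> and \<open>D = \<kappa> y + y\<^sup>2/\<gamma>\<close> with
\<open>y = (n+L+1/24)^(-1/4)\<close>, \<open>\<kappa>^4 = 91078.7328/\<pi>^8\<close>.  Then \<open>n > N\<^sub>A\<close> and \<open>n > N\<^sub>B\<close> say that \<open>(2+\<epsilon>) y\<^sup>2/\<gamma> < \<epsilon>/A\<close> and
\<open>(2+\<epsilon>) \<kappa> y < \<epsilon>/B\<close>, and \<open>n > N\<^sub>D\<close> says \<open>e^x < (1+\<epsilon>)/(1 + \<epsilon>(1/A+1/B+1/C))\<close>.  Together they give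
\<open>e^x (1+D) < (1+\<epsilon>)(1 - e^x D)\<close>, hence \<open>e^x (1+D) exp(e^x D) \<le> 1+\<epsilon>\<close>
(\<open>threshold_consequences\<close>).  So \<open>D\<close> is the relative error that the thresholds
leave room for; it is of order \<open>n^(-1/4)\<close>, larger than the errors above, and
\<open>q_growth_bound\<close> shows \<open>q(n+L) \<le> e^x (1+D) exp(e^x D) q(n)\<close>.
\<close>

section \<open>Elementary properties of the counting function\<close>

lemma distinct_partitions_0 [simp]: "distinct_partitions 0 m = {{}}"
  by (fastforce simp: distinct_partitions_def)

lemma rho_0 [simp]: "rho 0 m = 1"
  by (simp add: rho_def)

lemma rho_eq_0: "0 < n \<Longrightarrow> n < m \<Longrightarrow> rho n m = 0"
proof -
  assume n: "0 < n" "n < m"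
  have "distinct_partitions n m = {}"
  proof (rule ccontr)
    assume "distinct_partitions n m \<noteq> {}"
    then obtain S where S: "finite S" "\<forall>k\<in>S. m \<le> k" "\<Sum>S = n"
      by (auto simp: distinct_partitions_def)
    with n obtain k where "k \<in> S" by fastforce
    with S have "k \<le> n" using member_le_sum[of k S "\<lambda>x. x"] by simp
    with S \<open>k \<in> S\<close> n show False by auto
  qed
  then show ?thesis by (simp add: rho_def)
qed

lemma card_partitions_with_part:
  assumes "1 \<le> j" "m \<le> j" "j \<le> n"
  shows "card {S \<in> distinct_partitions n m. j \<in> S} = card {S \<in> distinct_partitions (n - j) m. j \<notin> S}"
proof (rule bij_betw_same_card[of "\<lambda>S. S - {j}"], rule bij_betw_byWitness[where f' = "insert j"])
  show "(\<lambda>S. S - {j}) ` {S \<in> distinct_partitions n m. j \<in> S} \<subseteq> {S \<in> distinct_partitions (n - j) m. j \<notin> S}"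
    by (auto simp: distinct_partitions_def sum_diff1_nat)
  show "insert j ` {S \<in> distinct_partitions (n - j) m. j \<notin> S} \<subseteq> {S \<in> distinct_partitions n m. j \<in> S}"
    using assms by (auto simp: distinct_partitions_def)
qed auto

lemma rho_split:
  assumes "1 \<le> m" "m \<le> n"
  shows "rho n m = rho n (Suc m) + rho (n - m) (Suc m)"
proof -
  have drop: "{S \<in> distinct_partitions k m. m \<notin> S} = distinct_partitions k (Suc m)" for k
  proof -
    have "(\<forall>i\<in>S. Suc m \<le> i) \<longleftrightarrow> (\<forall>i\<in>S. m \<le> i) \<and> m \<notin> S" for S
      by (metis Suc_leD le_antisym not_less_eq_eq order_refl)
    then show ?thesis unfolding distinct_partitions_def by blast
  qed
  have "rho n m = card {S \<in> distinct_partitions n m. m \<in> S} + card {S \<in> distinct_partitions n m. m \<notin> S}"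
    unfolding rho_def
    by (subst card_Un_disjoint[symmetric])
       (auto intro: finite_subset[OF _ finite_distinct_partitions] intro!: arg_cong[where f = card])
  then show ?thesis
    using card_partitions_with_part[of m m n] assms by (simp add: drop rho_def)
qed

lemma rho_pos: "1 \<le> m \<Longrightarrow> m \<le> n \<Longrightarrow> 1 \<le> rho n m"
proof -
  assume "1 \<le> m" "m \<le> n"
  then have "{n} \<in> distinct_partitions n m" by (auto simp: distinct_partitions_def)
  then show ?thesis
    using finite_distinct_partitions[of n m] by (auto simp: rho_def Suc_le_eq card_gt_0_iff)
qed

text \<open>
Increasing the largest part by one is injective, because the enlarged part is still the
largest one and can be decreased again.
\<close>

lemma rho_le_Suc: "1 \<le> n \<Longrightarrow> rho n m \<le> rho (Suc n) m"
proof -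
  assume n: "1 \<le> n"
  define up where "up S = insert (Suc (Max S)) (S - {Max S})" for S :: "nat set"
  define down where "down S = insert (Max S - 1) (S - {Max S})" for S :: "nat set"
  have ne: "S \<noteq> {}" if "S \<in> distinct_partitions n m" for S
    using that n by (auto simp: distinct_partitions_def)
  have max_up: "Max (up S) = Suc (Max S)" if "S \<in> distinct_partitions n m" for S
    using that ne[OF that] unfolding up_def distinct_partitions_def
    by (intro Max_eqI) (auto intro: le_SucI)
  have inv: "down (up S) = S" if "S \<in> distinct_partitions n m" for S
  proof -
    have "finite S" using that by (auto simp: distinct_partitions_def)
    then have "Suc (Max S) \<notin> S" "Max S \<in> S"
      using ne[OF that] by (meson Max_ge not_less_eq_eq order_refl, simp)
    moreover have "up S - {Suc (Max S)} = S - {Max S}"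
      using \<open>Suc (Max S) \<notin> S\<close> by (auto simp: up_def)
    ultimately show ?thesis
      unfolding down_def max_up[OF that] by auto
  qed
  have "up S \<in> distinct_partitions (Suc n) m" if S: "S \<in> distinct_partitions n m" for S
  proof -
    have fin: "finite S" and sm: "\<Sum>S = n" and k: "\<forall>k\<in>S. 0 < k \<and> m \<le> k" using S by (auto simp: distinct_partitions_def)
    have "Max S \<in> S" "Suc (Max S) \<notin> S" using fin ne[OF S] by (simp, meson Max_ge not_less_eq_eq order_refl)
    then have "\<Sum>(up S) = Suc (Max S) + (n - Max S)"
      using fin sm by (simp add: up_def sum_diff1_nat)
    moreover have "Max S \<le> n" using member_le_sum[of "Max S" S "\<lambda>x. x"] fin sm \<open>Max S \<in> S\<close> by simp
    moreover have "\<forall>k\<in>up S. 0 < k \<and> m \<le> k" using k \<open>Max S \<in> S\<close> by (auto simp: up_def)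
    ultimately show ?thesis using fin by (simp add: distinct_partitions_def up_def)
  qed
  then have "up ` distinct_partitions n m \<subseteq> distinct_partitions (Suc n) m" by blast
  moreover have "inj_on up (distinct_partitions n m)"
    using inv by (rule inj_on_inverseI)
  ultimately show ?thesis
    unfolding rho_def by (intro card_inj_on_le finite_distinct_partitions)
qed

lemma rho_mono:
  assumes "1 \<le> n" "n \<le> n'"
  shows "rho n m \<le> rho n' m"
  using assms(2,1)
proof (induction n' rule: dec_induct)
  case (step k)
  then show ?case using rho_le_Suc[of k m] by simp
qed simp

lemma rho_1_le_Suc: "rho n 1 \<le> rho (Suc n) 1"
  using rho_le_Suc[of n 1] rho_pos[of 1 1] by (cases n) auto

section \<open>Reduction to least part one\<close>

text \<open>
Splitting off the part \<open>m\<close> writes each side of the assumption as a sum of two values of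
\<open>\<rho>(\<cdot>, m+1)\<close>: on the left both are at least \<open>\<rho>(n+\<mu>, m+1)\<close>, on the right both are at most
\<open>\<rho>(n, m+1)\<close>.  The factor 2 cancels.
\<close>

lemma growth_bound_increase_min_part:
  fixes \<epsilon> :: real
  assumes "1 \<le> m" "m < n" "0 \<le> \<epsilon>"
    and "real (rho (n + \<mu> + m) m) \<le> (1 + \<epsilon>) * real (rho n m)"
  shows "real (rho (n + \<mu>) (Suc m)) \<le> (1 + \<epsilon>) * real (rho n (Suc m))"
proof -
  have le: "rho (n - m) (Suc m) \<le> rho n (Suc m)" using assms by (intro rho_mono) auto
  have "2 * rho (n + \<mu>) (Suc m) \<le> rho (n + \<mu> + m) (Suc m) + rho (n + \<mu>) (Suc m)"
    using rho_mono[of "n + \<mu>" "n + \<mu> + m" "Suc m"] assms by simp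
  also have "\<dots> = rho (n + \<mu> + m) m" using rho_split[of m "n + \<mu> + m"] assms by simp
  finally have "2 * real (rho (n + \<mu>) (Suc m)) \<le> (1 + \<epsilon>) * real (rho n m)"
    using assms(4) by linarith
  also have "\<dots> \<le> (1 + \<epsilon>) * (2 * real (rho n (Suc m)))"
    using rho_split[of m n] le assms by (intro mult_left_mono) auto
  finally show ?thesis by simp
qed

lemma growth_bound_all_min_parts:
  fixes \<epsilon> :: real
  assumes "1 \<le> m" "m \<le> n" "0 \<le> \<epsilon>"
    and "real (rho (n + (\<mu> + m * (m - 1) div 2)) 1) \<le> (1 + \<epsilon>) * real (rho n 1)"
  shows "real (rho (n + \<mu>) m) \<le> (1 + \<epsilon>) * real (rho n m)"
  using assms(1,2,4)
proof (induction m arbitrary: \<mu> rule: dec_induct)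
  case base
  then show ?case by simp
next
  case (step m)
  have "Suc m * (Suc m - 1) = m * (m - 1) + 2 * m" using step.hyps by (cases m) auto
  then have "\<mu> + Suc m * (Suc m - 1) div 2 = (\<mu> + m) + m * (m - 1) div 2" by simp
  then show ?case
    using step.IH[of "\<mu> + m"] step.prems step.hyps assms(3)
      growth_bound_increase_min_part[of m n \<epsilon> \<mu>]
    by (simp add: add.assoc)
qed

section \<open>The divisor-sum recurrence\<close>

text \<open>
Removing \<open>j\<close> from a partition of \<open>n\<close> leaves a partition of \<open>n - j\<close> without the part \<open>j\<close>, so the
numbers \<open>f(n)\<close> of partitions containing \<open>j\<close> satisfy \<open>f(n) + f(n-j) = q(n-j)\<close>; unrolling this gives
the alternating sum.
\<close>

lemma card_partitions_with_part_alternating: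
  assumes "1 \<le> j"
  shows "real (card {S \<in> distinct_partitions n 1. j \<in> S})
       = (\<Sum>i<n div j. (-1)^i * real (rho (n - Suc i * j) 1))"
proof (induction n rule: less_induct)
  case (less n)
  show ?case
  proof (cases "n < j")
    case True
    have "{S \<in> distinct_partitions n 1. j \<in> S} = {}"
      using True member_le_sum[of j _ "\<lambda>x. x"] by (force simp: distinct_partitions_def)
    then have "card {S \<in> distinct_partitions n 1. j \<in> S} = 0" by (simp only: card.empty)
    then show ?thesis using True by simp
  next
    case False
    have "card {S \<in> distinct_partitions (n - j) 1. j \<in> S} + card {S \<in> distinct_partitions (n - j) 1. j \<notin> S} = rho (n - j) 1"
      unfolding rho_def
      by (subst card_Un_disjoint[symmetric])
         (auto intro: finite_subset[OF _ finite_distinct_partitions] intro!: arg_cong[where f = card])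
    then have "real (card {S \<in> distinct_partitions n 1. j \<in> S})
       = real (rho (n - j) 1) - real (card {S \<in> distinct_partitions (n - j) 1. j \<in> S})"
      using card_partitions_with_part[of j 1 n] False assms by simp
    also have "\<dots> = real (rho (n - j) 1) - (\<Sum>i<(n - j) div j. (-1)^i * real (rho (n - j - Suc i * j) 1))"
      using less.IH[of "n - j"] False assms by simp
    also have "\<dots> = (\<Sum>i<Suc ((n - j) div j). (-1)^i * real (rho (n - Suc i * j) 1))"
      by (subst sum.lessThan_Suc_shift) (simp add: sum_negf diff_diff_eq add.commute)
    also have "Suc ((n - j) div j) = n div j" using False assms by (simp add: le_div_geq)
    finally show ?thesis .
  qed
qed

text \<open>
Both sides are the sum of all parts of all partitions of \<open>n\<close> into distinct parts.
\<close>

lemma rho_recurrence: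
  "real n * real (rho n 1) = (\<Sum>j=1..n. real j * (\<Sum>i<n div j. (-1)^i * real (rho (n - Suc i * j) 1)))"
proof -
  let ?P = "distinct_partitions n 1"
  have "real n * real (rho n 1) = (\<Sum>S\<in>?P. real (\<Sum>S))"
    by (simp add: rho_def distinct_partitions_def)
  also have "\<dots> = (\<Sum>S\<in>?P. \<Sum>j=1..n. if j \<in> S then real j else 0)"
  proof (rule sum.cong[OF refl])
    fix S assume S: "S \<in> ?P"
    have "S \<subseteq> {1..n}"
      using S member_le_sum[of _ S "\<lambda>x. x"] by (force simp: distinct_partitions_def)
    then show "real (\<Sum>S) = (\<Sum>j=1..n. if j \<in> S then real j else 0)"
      by (simp add: sum.inter_restrict[symmetric] Int_absorb1 inf.absorb2)
  qed
  also have "\<dots> = (\<Sum>j=1..n. \<Sum>S\<in>?P. if j \<in> S then real j else 0)" by (rule sum.swap)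
  also have "\<dots> = (\<Sum>j=1..n. real j * real (card {S \<in> ?P. j \<in> S}))"
    by (intro sum.cong refl) (simp add: sum.inter_filter[symmetric] finite_distinct_partitions)
  also have "\<dots> = (\<Sum>j=1..n. real j * (\<Sum>i<n div j. (-1)^i * real (rho (n - Suc i * j) 1)))"
    by (intro sum.cong refl) (subst card_partitions_with_part_alternating, auto)
  finally show ?thesis .
qed

section \<open>Summation by parts\<close>

definition q :: "nat \<Rightarrow> real" where "q n = real (rho n 1)"
definition q1 :: "nat \<Rightarrow> real" where "q1 n = (\<Sum>j\<le>n. q j)"
definition q2 :: "nat \<Rightarrow> real" where "q2 n = (\<Sum>j\<le>n. q1 j)"
text \<open>
The backward difference of \<open>q\<close>, with \<open>q(-1) = 0\<close>.
\<close>

definition dq :: "nat \<Rightarrow> real" where "dq l = (if l = 0 then 1 else q l - q (l - 1))"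
definition tri :: "nat \<Rightarrow> real" where "tri a = (\<Sum>j=1..a. real j)"
text \<open>
The sum of \<open>(-1)^i j\<close> over all \<open>i \<ge> 0\<close>, \<open>j \<ge> 1\<close> with \<open>(i+1) j \<le> k\<close>, grouped by \<open>i\<close>.  It is the
summatory function of the sum of the odd divisors.
\<close>

definition kernel :: "nat \<Rightarrow> real" where "kernel k = (\<Sum>i<k. (-1)^i * tri (k div Suc i))"

lemma q_0 [simp]: "q 0 = 1" by (simp add: q_def)
lemma dq_0 [simp]: "dq 0 = 1" by (simp add: dq_def)
lemma dq_nonneg: "0 \<le> dq l"
  using rho_1_le_Suc[of "l - 1"] by (cases l) (auto simp: dq_def q_def)
lemma q_eq_sum_dq: "q n = (\<Sum>l\<le>n. dq l)"
  by (induction n) (auto simp: dq_def)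
lemma q_nonneg: "0 \<le> q n" by (simp add: q_def)
lemma q1_Suc: "q1 (Suc n) = q1 n + q (Suc n)" by (simp add: q1_def)
lemma q2_Suc: "q2 (Suc n) = q2 n + q1 (Suc n)" by (simp add: q2_def)
lemma q1_pos: "0 < q1 n"
  by (induction n) (auto simp: q1_Suc q1_def intro: add_pos_nonneg q_nonneg)
lemma q2_pos: "0 < q2 n"
  by (induction n) (auto simp: q2_Suc q2_def intro: add_pos_pos q1_pos)

lemma tri_altdef: "tri a = real a * (real a + 1) / 2"
  by (induction a) (auto simp: tri_def field_simps)

text \<open>
Summation by parts in \<open>rho_recurrence\<close>: expand every \<open>q(n - (i+1)j)\<close> as the sum of the differences
\<open>dq l\<close> with \<open>l \<le> n - (i+1)j\<close> and collect the coefficient of each \<open>dq l\<close>.  The gain is that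
the weights \<open>dq l\<close> are nonnegative and the coefficients are smooth to leading order.
\<close>

lemma q_convolution: "real n * q n = (\<Sum>l\<le>n. dq l * kernel (n - l))"
proof -
  let ?t = "\<lambda>j i l. if Suc i * j + l \<le> n then real j * (-1)^i * dq l else 0"
  have "real n * q n = (\<Sum>j=1..n. \<Sum>i<n div j. \<Sum>l\<le>n - Suc i * j. real j * (-1)^i * dq l)"
    using rho_recurrence[of n] unfolding q_def[symmetric]
    by (simp only: q_eq_sum_dq[of "n - _"] sum_distrib_left mult.assoc)
  also have "\<dots> = (\<Sum>j=1..n. \<Sum>i<n. \<Sum>l\<le>n. ?t j i l)"
  proof (rule sum.cong[OF refl])
    fix j assume j: "j \<in> {1..n}"
    have iff: "i < n div j \<longleftrightarrow> Suc i * j \<le> n" for i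
      using j less_eq_div_iff_mult_less_eq[of j "Suc i" n] by (simp add: Suc_le_eq)
    have "(\<Sum>l\<le>n. ?t j i l) = (if i < n div j then \<Sum>l\<le>n - Suc i * j. real j * (-1)^i * dq l else 0)" for i
    proof (cases "i < n div j")
      case True
      then have le: "Suc i * j \<le> n" using iff by simp
      have "(\<Sum>l\<le>n. ?t j i l) = (\<Sum>l\<le>n - Suc i * j. ?t j i l)"
        using le by (intro sum.mono_neutral_right) auto
      also have "\<dots> = (\<Sum>l\<le>n - Suc i * j. real j * (-1)^i * dq l)"
        using le by (intro sum.cong) auto
      finally show ?thesis using True by simp
    next
      case False
      then have "n < Suc i * j" using iff by simp
      then show ?thesis using False by (auto intro!: sum.neutral)
    qed
    then have "(\<Sum>i<n. \<Sum>l\<le>n. ?t j i l)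
        = (\<Sum>i<n. if i < n div j then \<Sum>l\<le>n - Suc i * j. real j * (-1)^i * dq l else 0)"
      by (simp only:)
    also have "\<dots> = (\<Sum>i<n div j. \<Sum>l\<le>n - Suc i * j. real j * (-1)^i * dq l)"
      using div_le_dividend[of n j] by (intro sum.mono_neutral_cong_right) auto
    finally show "(\<Sum>i<n div j. \<Sum>l\<le>n - Suc i * j. real j * (-1)^i * dq l) = (\<Sum>i<n. \<Sum>l\<le>n. ?t j i l)"
      by simp
  qed
  also have "\<dots> = (\<Sum>j=1..n. \<Sum>l\<le>n. \<Sum>i<n. ?t j i l)"
    by (intro sum.cong refl sum.swap)
  also have "\<dots> = (\<Sum>l\<le>n. \<Sum>j=1..n. \<Sum>i<n. ?t j i l)"
    by (rule sum.swap)
  also have "\<dots> = (\<Sum>l\<le>n. \<Sum>i<n. \<Sum>j=1..n. ?t j i l)"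
    by (intro sum.cong refl sum.swap)
  also have "\<dots> = (\<Sum>l\<le>n. dq l * kernel (n - l))"
  proof (rule sum.cong[OF refl])
    fix l assume l: "l \<in> {..n}"
    have "(\<Sum>j=1..n. ?t j i l) = (if i < n - l then dq l * ((-1)^i * tri ((n - l) div Suc i)) else 0)" for i
    proof -
      have "(\<Sum>j=1..n. ?t j i l) = (\<Sum>j=1..(n - l) div Suc i. real j * (-1)^i * dq l)"
      proof (rule sum.mono_neutral_cong_right)
        have "(n - l) div Suc i \<le> n" by (meson diff_le_self div_le_dividend le_trans)
        then show "{1..(n - l) div Suc i} \<subseteq> {1..n}" by auto
        have iff: "j \<le> (n - l) div Suc i \<longleftrightarrow> Suc i * j + l \<le> n" for j
          using less_eq_div_iff_mult_less_eq[of "Suc i" j "n - l"] l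
          by (simp add: le_diff_conv2 mult.commute)
        show "\<forall>j\<in>{1..n} - {1..(n - l) div Suc i}. ?t j i l = 0"
          using iff by (auto simp del: mult_Suc)
        show "?t j i l = real j * (-1)^i * dq l" if "j \<in> {1..(n - l) div Suc i}" for j
          using iff[of j] that by (auto simp del: mult_Suc)
      qed simp
      also have "\<dots> = dq l * ((-1)^i * tri ((n - l) div Suc i))"
        by (simp add: tri_def sum_distrib_left sum_distrib_right mult_ac)
      finally show ?thesis by (simp add: tri_def)
    qed
    then have "(\<Sum>i<n. \<Sum>j=1..n. ?t j i l)
       = (\<Sum>i<n. if i < n - l then dq l * ((-1)^i * tri ((n - l) div Suc i)) else 0)"
      by (simp only:)
    also have "\<dots> = (\<Sum>i<n - l. dq l * ((-1)^i * tri ((n - l) div Suc i)))"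
      by (intro sum.mono_neutral_cong_right) auto
    finally show "(\<Sum>i<n. \<Sum>j=1..n. ?t j i l) = dq l * kernel (n - l)"
      by (simp add: kernel_def sum_distrib_left)
  qed
  finally show ?thesis .
qed

text \<open>
Convolving with \<open>k\<close> or with \<open>k(k+1)/2\<close> undoes the difference and sums once or twice more.
\<close>

lemma sum_dq_linear: "(\<Sum>l\<le>Suc n. dq l * real (Suc n - l)) = q1 n"
proof (induction n)
  case 0 then show ?case by (simp add: q1_def)
next
  case (Suc n)
  have "(\<Sum>l\<le>Suc (Suc n). dq l * real (Suc (Suc n) - l)) = (\<Sum>l\<le>Suc n. dq l * real (Suc n - l) + dq l)"
    by (subst sum.atMost_Suc) (auto intro!: sum.cong simp: Suc_diff_le algebra_simps)
  then show ?case using Suc by (simp add: sum.distrib q1_Suc q_eq_sum_dq del: sum.atMost_Suc)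
qed

lemma sum_dq_tri: "(\<Sum>l\<le>Suc n. dq l * tri (Suc n - l)) = q2 n"
proof (induction n)
  case 0 then show ?case by (simp add: q1_def q2_def tri_def)
next
  case (Suc n)
  have *: "tri (Suc a) = tri a + real (Suc a)" for a by (simp add: tri_def)
  have "(\<Sum>l\<le>Suc (Suc n). dq l * tri (Suc (Suc n) - l))
      = (\<Sum>l\<le>Suc n. dq l * tri (Suc n - l) + dq l * real (Suc (Suc n) - l))"
    by (subst sum.atMost_Suc) (auto intro!: sum.cong simp: Suc_diff_le * algebra_simps tri_def[of 0])
  also have "\<dots> = q2 n + (\<Sum>l\<le>Suc (Suc n). dq l * real (Suc (Suc n) - l))"
    by (simp add: sum.distrib Suc del: sum.atMost_Suc of_nat_Suc) simp
  finally show ?case using sum_dq_linear[of "Suc n"] by (simp add: q2_Suc)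
qed

section \<open>Asymptotics of the kernel\<close>

text \<open>
The alternating series is the full series \<open>\<pi>\<^sup>2/6\<close> minus twice its even-indexed part, which is
a quarter of the full series.
\<close>

lemma alternating_inverse_squares_sums: "(\<lambda>n. (-1)^n * (1 / real (n + 1)^2)) sums (pi\<^sup>2 / 12)"
proof -
  let ?a = "\<lambda>n. 1 / real (n + 1)^2"
  have a: "?a sums (pi\<^sup>2 / 6)" using inverse_squares_sums by (simp add: add.commute)
  have "(\<lambda>n. - (1/2) * ?a n) sums (- (1/2) * (pi\<^sup>2 / 6))" by (rule sums_mult[OF a])
  then have "(\<lambda>n. if even n then 0 else - (1/2) * ?a ((n - 1) div 2)) sums (- (1/2) * (pi\<^sup>2 / 6) + 0)"
    by (rule sums_if) simp
  from sums_add[OF a this]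
  have "(\<lambda>n. ?a n + (if even n then 0 else - (1/2) * ?a ((n - 1) div 2))) sums (pi\<^sup>2 / 12)"
    by simp
  moreover have "?a n + (if even n then 0 else - (1/2) * ?a ((n - 1) div 2)) = (-1)^n * ?a n" for n
  proof (cases "even n")
    case False
    then obtain b where b: "n = 2 * b + 1" by (auto elim: oddE)
    have "real (n + 1) ^ 2 = 4 * real (b + 1) ^ 2" by (simp add: b power2_eq_square algebra_simps)
    then show ?thesis using b by simp
  qed simp
  ultimately show ?thesis by simp
qed

lemma alternating_inverse_squares_bounds:
  shows "(\<Sum>i<2*n. (-1)^i * (1 / real (i + 1)^2)) \<le> pi\<^sup>2 / 12"
    and "pi\<^sup>2 / 12 \<le> (\<Sum>i<2*n+1. (-1)^i * (1 / real (i + 1)^2))"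
proof -
  let ?a = "\<lambda>n. 1 / real (n + 1)^2"
  have lim: "?a \<longlonglongrightarrow> 0"
    using summable_LIMSEQ_zero[OF sums_summable[OF inverse_squares_sums]] by (simp add: add.commute)
  have nn: "0 \<le> ?a n" and dec: "?a (Suc n) \<le> ?a n" for n
    by (auto intro!: divide_left_mono power_mono)
  have eq: "(\<Sum>i. (-1)^i * ?a i) = pi\<^sup>2 / 12"
    using sums_unique[OF alternating_inverse_squares_sums] by simp
  note L = summable_Leibniz'[OF lim nn dec]
  show "(\<Sum>i<2*n. (-1)^i * ?a i) \<le> pi\<^sup>2 / 12" using L(2)[of n] eq by simp
  show "pi\<^sup>2 / 12 \<le> (\<Sum>i<2*n+1. (-1)^i * ?a i)" using L(4)[of n] eq by simp
qed

lemma alternating_inverse_squares_tail: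
  "\<bar>(\<Sum>i<k. (-1)^i * (1 / real (i + 1)^2)) - pi\<^sup>2 / 12\<bar> \<le> 1 / real (k + 1)^2"
proof (cases "even k")
  case True
  then obtain n where "k = 2 * n" by (auto elim: evenE)
  then show ?thesis using alternating_inverse_squares_bounds[of n] by simp
next
  case False
  then obtain n where "k = 2 * n + 1" by (auto elim: oddE)
  then show ?thesis
    using alternating_inverse_squares_bounds(1)[of "Suc n"] alternating_inverse_squares_bounds(2)[of n] by simp
qed

lemma tri_div_approx: "\<bar>tri (k div Suc i) - (real k / real (i + 1))^2 / 2\<bar> \<le> real k / real (i + 1) / 2"
proof -
  define f where "f = real (k div Suc i)"
  define y where "y = real k / real (i + 1)"
  have "f = of_int \<lfloor>y\<rfloor>"
    using floor_divide_of_nat_eq[of k "Suc i", where ?'a = real] by (simp add: f_def y_def)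
  then have f: "0 \<le> f" "f \<le> y" and fy: "y < f + 1"
    using of_nat_0_le_iff[of "k div Suc i", where ?'a = real] by (simp_all only: f_def) linarith+
  have "f^2 \<le> y^2" using f by (intro power_mono)
  moreover have "y * (y - 1) \<le> (f + 1) * f"
  proof (cases "1 \<le> y")
    case True then show ?thesis using f fy by (intro mult_mono) auto
  next
    case False
    then have "y * (y - 1) \<le> 0" using f by (intro mult_nonneg_nonpos) auto
    then show ?thesis using f by (smt (verit) mult_nonneg_nonneg)
  qed
  ultimately have "f * (f + 1) - y^2 \<le> y" "- y \<le> f * (f + 1) - y^2"
    using f by (simp_all add: algebra_simps power2_eq_square)
  then have "\<bar>f * (f + 1) / 2 - y^2 / 2\<bar> \<le> y / 2" by linarith
  then show ?thesis by (simp add: tri_altdef f_def y_def)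
qed

lemma harm_le_ln: "1 \<le> k \<Longrightarrow> harm k \<le> 1 + ln (real k)"
  using euler_mascheroni_sequence_decreasing[of 1 k] by (simp add: harm_expand)

text \<open>
Replacing \<open>tri (k div (i+1))\<close> by \<open>(k/(i+1))\<^sup>2/2\<close> costs at most \<open>k/(2(i+1))\<close> in each term, which adds up to
a harmonic sum; the main terms form a partial sum of the alternating series for \<open>\<pi>\<^sup>2/12\<close>.
\<close>

lemma kernel_approx_log:
  assumes "1 \<le> k"
  shows "\<bar>kernel k - pi\<^sup>2 / 12 * real k ^ 2 / 2\<bar> \<le> real k / 2 * (2 + ln (real k))"
proof -
  define P where "P = (\<Sum>i<k. (-1)^i * (1 / real (i + 1)^2))"
  let ?e = "\<lambda>i. tri (k div Suc i) - (real k / real (i + 1))^2 / 2"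
  have "kernel k - pi\<^sup>2 / 12 * real k ^ 2 / 2
      = (\<Sum>i<k. (-1)^i * ?e i) + real k ^ 2 / 2 * (P - pi\<^sup>2 / 12)"
  proof -
    have "(\<Sum>i<k. (-1)^i * ?e i)
        = (\<Sum>i<k. (-1)^i * tri (k div Suc i) - real k ^ 2 / 2 * ((-1)^i * (1 / real (i + 1)^2)))"
      by (rule sum.cong[OF refl]) (simp add: field_simps)
    also have "\<dots> = kernel k - real k ^ 2 / 2 * P"
      unfolding P_def kernel_def by (simp only: sum_subtractf sum_distrib_left)
    finally show ?thesis by (simp add: algebra_simps)
  qed
  then have "\<bar>kernel k - pi\<^sup>2 / 12 * real k ^ 2 / 2\<bar>
      \<le> \<bar>\<Sum>i<k. (-1)^i * ?e i\<bar> + \<bar>real k ^ 2 / 2 * (P - pi\<^sup>2 / 12)\<bar>"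
    by (simp only: abs_triangle_ineq)
  moreover have "\<bar>\<Sum>i<k. (-1)^i * ?e i\<bar> \<le> (\<Sum>i<k. real k / real (i + 1) / 2)"
    by (rule order_trans[OF sum_abs], rule sum_mono) (simp only: abs_mult power_abs abs_minus abs_one power_one mult_1 tri_div_approx)
  moreover have "(\<Sum>i<k. real k / real (i + 1) / 2) = real k / 2 * harm k"
    unfolding harm_altdef sum_distrib_left
    by (rule sum.cong[OF refl]) (simp add: inverse_eq_divide)
  moreover have "\<bar>real k ^ 2 / 2 * (P - pi\<^sup>2 / 12)\<bar> \<le> real k ^ 2 / 2 * (1 / real (k + 1)^2)"
  proof -
    have "\<bar>P - pi\<^sup>2 / 12\<bar> \<le> 1 / real (k + 1)^2"
      unfolding P_def by (rule alternating_inverse_squares_tail)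
    then have "real k ^ 2 / 2 * \<bar>P - pi\<^sup>2 / 12\<bar> \<le> real k ^ 2 / 2 * (1 / real (k + 1)^2)"
      by (rule mult_left_mono) simp
    then show ?thesis by (simp only: abs_mult) simp
  qed
  moreover have "real k ^ 2 / 2 * (1 / real (k + 1)^2) \<le> real k / 2"
  proof -
    have "real k * 1 \<le> real (k + 1) * real (k + 1)" by (intro mult_mono) auto
    then have "real k * (real k * 1) \<le> real k * (real (k + 1) * real (k + 1))" by (intro mult_left_mono) auto
    then show ?thesis by (simp add: divide_le_eq power2_eq_square)
  qed
  ultimately have "\<bar>kernel k - pi\<^sup>2 / 12 * real k ^ 2 / 2\<bar> \<le> real k / 2 * harm k + real k / 2"
    by linarith
  also have "\<dots> \<le> real k / 2 * (2 + ln (real k))"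
    using mult_left_mono[OF harm_le_ln[OF assms], of "real k / 2"] by (simp add: algebra_simps)
  finally show ?thesis .
qed

text \<open>
The logarithm is replaced by its tangent at \<open>k = z\<^sup>2\<close>, so that the error becomes a quadratic polynomial in
\<open>k\<close>, whose convolution with \<open>dq\<close> is explicit.  The parameter \<open>z\<close> is later taken near
\<open>n^(1/4)\<close>, because the convolution is concentrated at \<open>k\<close> of order \<open>\<surd>n\<close>.
\<close>

lemma kernel_approx:
  assumes "0 < z"
  shows "\<bar>kernel k - pi\<^sup>2 / 12 * real k ^ 2 / 2\<bar> \<le> real k / 2 * (z + 2/5 + real k / z^2)"
proof (cases "k = 0")
  case True then show ?thesis by (simp add: kernel_def)
next
  case False
  \<comment> \<open>\<open>ln z \<le> z/2 - 1 + ln 2\<close> is the tangent at \<open>z = 2\<close>, close to the smallest \<open>z\<close> used, \<open>26^(1/4) = 2.26\<close>\<close>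
  have "ln (real k) = ln (real k / z^2) + 2 * (ln (z / 2) + ln 2)"
    using False assms by (simp add: ln_div ln_realpow)
  also have "\<dots> \<le> (real k / z^2 - 1) + 2 * ((z / 2 - 1) + 25/36)"
    using False assms ln2_le_25_over_36 by (intro add_mono mult_left_mono ln_le_minus_one) auto
  finally have "2 + ln (real k) \<le> z + 2/5 + real k / z^2" by simp
  then have "real k / 2 * (2 + ln (real k)) \<le> real k / 2 * (z + 2/5 + real k / z^2)"
    by (rule mult_left_mono) simp
  then show ?thesis
    using kernel_approx_log[of k] False by linarith
qed

section \<open>The discrete Bessel inequalities\<close>

lemma sum_dq_quadratic:
  "(\<Sum>l\<le>Suc n. dq l * (a * tri (Suc n - l) + b * real (Suc n - l))) = a * q2 n + b * q1 n"
proof -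
  have "(\<Sum>l\<le>Suc n. dq l * (a * tri (Suc n - l) + b * real (Suc n - l)))
      = (\<Sum>l\<le>Suc n. a * (dq l * tri (Suc n - l)) + b * (dq l * real (Suc n - l)))"
    by (rule sum.cong[OF refl]) (simp only: distrib_left mult.left_commute[of "dq _"])
  also have "\<dots> = a * q2 n + b * q1 n"
    unfolding sum.distrib sum_distrib_left[symmetric] sum_dq_linear sum_dq_tri ..
  finally show ?thesis .
qed

text \<open>
The discrete form of \<open>n u'' \<le> \<gamma>\<^sup>2 u\<close> with error terms; \<open>q_lower\<close> is its counterpart.
\<close>

lemma q_upper:
  assumes "0 < z"
  shows "real (Suc n) * q (Suc n)
       \<le> (pi\<^sup>2 / 12 + 1 / z^2) * q2 n + (z + 2/5 - (pi\<^sup>2 / 12 + 1 / z^2)) / 2 * q1 n"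
proof -
  have up: "a \<le> t" if "\<bar>a - b\<bar> \<le> r" "b + r = t" for a b r t :: real
    using that by linarith
  have eq: "C * k ^ 2 / 2 + k / 2 * (Z + k * w) = (C + w) * (k * (k + 1) / 2) + (Z - (C + w)) / 2 * k"
    for C k w Z :: real by (simp add: field_simps power2_eq_square)
  have le: "kernel k \<le> (pi\<^sup>2 / 12 + 1 / z^2) * tri k + (z + 2/5 - (pi\<^sup>2 / 12 + 1 / z^2)) / 2 * real k" for k
    using kernel_approx[OF assms, of k] eq[of "pi\<^sup>2 / 12" "real k" "z + 2/5" "1 / z^2"]
    unfolding tri_altdef times_divide_eq_right[of _ 1 "z^2"] mult_1_right by (rule up)
  show ?thesis
    unfolding q_convolution sum_dq_quadratic[symmetric]
    by (rule sum_mono, rule mult_left_mono[OF le dq_nonneg])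
qed

lemma q_lower:
  assumes "0 < z"
  shows "(pi\<^sup>2 / 12 - 1 / z^2) * q2 n + - ((z + 2/5 + (pi\<^sup>2 / 12 - 1 / z^2)) / 2) * q1 n
       \<le> real (Suc n) * q (Suc n)"
proof -
  have low: "t \<le> a" if "\<bar>a - b\<bar> \<le> r" "t = b - r" for a b r t :: real
    using that by linarith
  have eq: "(C - w) * (k * (k + 1) / 2) + - ((Z + (C - w)) / 2) * k = C * k ^ 2 / 2 - k / 2 * (Z + k * w)"
    for C k w Z :: real by (simp add: field_simps power2_eq_square)
  have le: "(pi\<^sup>2 / 12 - 1 / z^2) * tri k + - ((z + 2/5 + (pi\<^sup>2 / 12 - 1 / z^2)) / 2) * real k \<le> kernel k" for k
    using kernel_approx[OF assms, of k] eq[of "pi\<^sup>2 / 12" "1 / z^2" "real k" "z + 2/5"]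
    unfolding tri_altdef times_divide_eq_right[of _ 1 "z^2"] mult_1_right by (rule low)
  show ?thesis
    unfolding q_convolution sum_dq_quadratic[symmetric]
    by (rule sum_mono, rule mult_left_mono[OF le dq_nonneg])
qed

section \<open>Riccati comparison for the partial sums\<close>

text \<open>
The constant in \<open>q(n) = exp (2\<gamma>\<surd>n + O(log n))\<close>.
\<close>

definition \<gamma> :: real where "\<gamma> = pi / sqrt 12"

lemma gamma_pos: "0 < \<gamma>" by (simp add: \<gamma>_def)
lemma gamma_sq: "\<gamma>^2 = pi\<^sup>2 / 12" by (simp add: \<gamma>_def power_divide)

text \<open>
Consecutive partial sums of the alternating series enclose \<open>\<pi>\<^sup>2/12\<close>; fifteen and sixteen terms give the
precision that the numerical estimates below need.
\<close>

lemma gamma_sq_bounds: "82/100 \<le> \<gamma>^2" "\<gamma>^2 \<le> 825/1000"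
proof -
  show "82/100 \<le> \<gamma>^2"
    using alternating_inverse_squares_bounds(1)[of 8] unfolding gamma_sq
    by (simp add: lessThan_nat_numeral)
  show "\<gamma>^2 \<le> 825/1000"
    using alternating_inverse_squares_bounds(2)[of 7] unfolding gamma_sq
    by (simp add: lessThan_nat_numeral)
qed

lemma gamma_bounds: "9055/10000 \<le> \<gamma>" "\<gamma> \<le> 9083/10000"
proof -
  show "9055/10000 \<le> \<gamma>"
    using gamma_sq_bounds(1) gamma_pos by (intro power2_le_imp_le[of "(9055/10000)" \<gamma>]) (auto simp: power2_eq_square)
  show "\<gamma> \<le> 9083/10000"
    using gamma_sq_bounds(2) gamma_pos by (intro power2_le_imp_le[of \<gamma> "(9083/10000)"]) (auto simp: power2_eq_square)
qed

definition root4_inv :: "nat \<Rightarrow> real" where "root4_inv m = root 4 (1 / real m)"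

text \<open>
The supersolution for \<open>q1(n)/q2(n-1)\<close>: the limiting behaviour \<open>\<gamma>/\<surd>n\<close> plus a term \<open>n^(-3/4)\<close> that
dominates all errors of the recurrence but stays below what the thresholds allow.
Everything is expressed through \<open>h = n^(-1/4)\<close>, so that the estimates become polynomial in \<open>h\<close>.
\<close>

definition ratio_bound :: "nat \<Rightarrow> real" where
  "ratio_bound m = \<gamma> * root4_inv m ^ 2 + root4_inv m ^ 3"

lemma root4_inv_pow4: "root4_inv m ^ 4 = 1 / real m"
  unfolding root4_inv_def by (rule real_root_pow_pos2) auto
lemma root4_inv_pos: "1 \<le> m \<Longrightarrow> 0 < root4_inv m"
  by (simp add: root4_inv_def)
lemma root4_inv_antimono: "1 \<le> m \<Longrightarrow> m \<le> n \<Longrightarrow> root4_inv n \<le> root4_inv m"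
  by (simp add: root4_inv_def frac_le)
lemma ratio_bound_antimono: "1 \<le> m \<Longrightarrow> m \<le> n \<Longrightarrow> ratio_bound n \<le> ratio_bound m"
  unfolding ratio_bound_def using gamma_pos root4_inv_pos[of n] root4_inv_antimono[of m n]
  by (intro add_mono mult_left_mono power_mono) auto
lemma ratio_bound_pos: "1 \<le> m \<Longrightarrow> 0 < ratio_bound m"
  unfolding ratio_bound_def using gamma_pos root4_inv_pos[of m]
  by (intro add_pos_pos mult_pos_pos zero_less_power) auto

lemma root4_inv_le: assumes "26 \<le> m" shows "root4_inv m \<le> 443/1000"
proof (rule power_le_imp_le_base[of _ 3])
  have "1 / real m \<le> 1 / 26" using assms by (intro divide_left_mono) auto
  then show "root4_inv m ^ Suc 3 \<le> (443/1000) ^ Suc 3"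
    using root4_inv_pow4[of m] by (simp add: eval_nat_numeral)
qed simp

text \<open>
This is \<open>(1+t)^(-1/4) \<ge> 1 - t/4\<close> with \<open>t = 1/m\<close>, obtained from \<open>(1 - t/4)^4 \<le> e^(-t) \<le> 1/(1+t)\<close>.
\<close>

lemma root4_inv_Suc_ge:
  assumes "1 \<le> m"
  shows "root4_inv m * (1 - root4_inv m ^ 4 / 4) \<le> root4_inv (Suc m)"
proof (rule power_le_imp_le_base[of _ 3])
  define t where "t = root4_inv m ^ 4"
  have t: "t = 1 / real m" by (simp add: t_def root4_inv_pow4)
  then have t01: "0 < t" "t \<le> 1" using assms by auto
  have "1 - t / 4 \<le> exp (- t / 4)" using exp_ge_add_one_self[of "- t / 4"] by simp
  then have "(1 - t / 4) ^ 4 \<le> exp (- t / 4) ^ 4" using t01 by (intro power_mono) auto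
  also have "\<dots> = exp (- t)" by (simp add: exp_of_nat_mult[symmetric])
  also have "\<dots> \<le> 1 / (1 + t)"
    using exp_ge_add_one_self[of t] t01 unfolding exp_minus inverse_eq_divide by (intro divide_left_mono) auto
  finally have "t * (1 - t / 4) ^ 4 \<le> t * (1 / (1 + t))" using t01 by (intro mult_left_mono) auto
  also have "\<dots> = 1 / real (Suc m)"
  proof -
    have "1 + t = real (Suc m) * t" using t assms by (simp add: field_simps)
    then show ?thesis using t01 by simp
  qed
  finally show "(root4_inv m * (1 - root4_inv m ^ 4 / 4)) ^ Suc 3 \<le> root4_inv (Suc m) ^ Suc 3"
    using root4_inv_pow4[of "Suc m"] by (simp add: power_mult_distrib t_def)
qed (use root4_inv_pos[of "Suc m"] in auto)

lemma ratio_bound_Suc_ge: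
  assumes "1 \<le> m"
  defines "h \<equiv> root4_inv m"
  shows "\<gamma> * h^2 * (1 - h^4 / 2) + h^3 * (1 - 3 * h^4 / 4) \<le> ratio_bound (Suc m)"
proof -
  define t where "t = h^4"
  have "t = 1 / real m" by (simp add: t_def h_def root4_inv_pow4)
  then have t01: "0 \<le> t" "t \<le> 1" using assms(1) by auto
  have h: "0 \<le> h" using root4_inv_pos[OF assms(1)] by (simp add: h_def)
  define u where "u = h * (1 - t / 4)"
  have u: "0 \<le> u" "u \<le> root4_inv (Suc m)"
    using root4_inv_Suc_ge[OF assms(1)] h t01 by (auto simp: u_def t_def h_def)
  have "1 - t / 2 \<le> (1 - t / 4)^2" by (simp add: power2_eq_square algebra_simps)
  then have a: "h^2 * (1 - t / 2) \<le> u^2" unfolding u_def power_mult_distrib by (rule mult_left_mono) simp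
  have "1 + real 3 * (- t / 4) \<le> (1 + (- t / 4)) ^ 3" using t01 by (intro Bernoulli_inequality) auto
  then have b: "h^3 * (1 - 3 * t / 4) \<le> u^3"
    unfolding u_def power_mult_distrib using h by (intro mult_left_mono) auto
  have "\<gamma> * (h^2 * (1 - t / 2)) + h^3 * (1 - 3 * t / 4) \<le> \<gamma> * u^2 + u^3"
    using a b gamma_pos by (intro add_mono mult_left_mono) auto
  also have "\<dots> \<le> ratio_bound (Suc m)"
    unfolding ratio_bound_def using u gamma_pos by (intro add_mono mult_left_mono power_mono) auto
  finally show ?thesis by (simp add: t_def mult.assoc)
qed

text \<open>
The supersolution inequality of the Riccati step, cleared of denominators.  The terms up to
\<open>h^4\<close> cancel, because \<open>\<gamma>/\<surd>n\<close> solves the leading-order equation; at order \<open>h^5\<close> the cross term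
\<open>2\<gamma>h^5\<close> of \<open>b\<^sup>2\<close> outweighs the loss \<open>\<gamma>h^5/2\<close> from the logarithmic error.
\<close>

lemma ratio_step_polynomial:
  fixes h :: real
  assumes h: "0 < h" "h \<le> 443/1000"
  defines "b \<equiv> \<gamma> * h^2 + h^3"
  shows "b * (1 + (h^3 - (42/100) * h^4) / 2) + h^4 * (\<gamma>^2 + h^2) * (1 + b)
       \<le> (\<gamma> * h^2 * (1 - h^4 / 2) + h^3 * (1 - 3 * h^4 / 4)) * (1 + b)"
proof -
  define P where "P = (3/2) * \<gamma> - h * ((29/100) * \<gamma> + (1/2)) - (54/100) * h^2
     - h * (\<gamma> + h) * (\<gamma>^2 + h^2 + \<gamma> * h^2 / 2 + (3/4) * h^3)"
  have eq: "(\<gamma> * h^2 * (1 - h^4 / 2) + h^3 * (1 - 3 * h^4 / 4)) * (1 + b)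
      - (b * (1 + (h^3 - (42/100) * h^4) / 2) + h^4 * (\<gamma>^2 + h^2) * (1 + b)) = h^5 * P"
    unfolding b_def P_def by (simp add: field_simps eval_nat_numeral)
  have h2: "h^2 \<le> 197/1000" "0 \<le> h^2" and h3: "h^3 \<le> 87/1000" "0 \<le> h^3"
    using power_mono[OF h(2), of 2] power_mono[OF h(2), of 3] h by (auto simp: power2_eq_square power3_eq_cube)
  have "h * ((29/100) * \<gamma> + (1/2)) \<le> (443/1000) * (77/100)" using h gamma_bounds by (intro mult_mono) auto
  moreover have "\<gamma> * h^2 \<le> (9083/10000) * (197/1000)" using h2 gamma_bounds by (intro mult_mono) auto
  then have "\<gamma>^2 + h^2 + \<gamma> * h^2 / 2 + (3/4) * h^3 \<le> 59/50" using gamma_sq_bounds h2 h3 by linarith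
  then have "h * (\<gamma> + h) * (\<gamma>^2 + h^2 + \<gamma> * h^2 / 2 + (3/4) * h^3) \<le> ((443/1000) * (13513/10000)) * (59/50)"
    using h gamma_bounds gamma_pos h3 by (intro mult_mono) auto
  ultimately have "0 \<le> P" unfolding P_def using gamma_bounds h2 by linarith
  then have "0 \<le> h^5 * P" using h by simp
  then show ?thesis using eq by linarith
qed

lemma q_values:
  "q 1 = 1" "q 2 = 1" "q 3 = 2" "q 4 = 2" "q 5 = 3" "q 6 = 4" "q 7 = 5" "q 8 = 6" "q 9 = 8"
  "q 10 = 10" "q 11 = 12" "q 12 = 15" "q 13 = 18" "q 14 = 22" "q 15 = 27" "q 16 = 32" "q 17 = 38"
  "q 18 = 46" "q 19 = 54" "q 20 = 64" "q 21 = 76" "q 22 = 89" "q 23 = 104" "q 24 = 122" "q 25 = 142" "q 26 = 165"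
  unfolding q_def by (simp_all add: rho_split rho_eq_0)

lemma q1_q2_26: "q1 26 = 1069" "q2 26 = 6287"
  by (simp_all add: q1_def q2_def atMost_nat_numeral q_values q_values(1)[unfolded One_nat_def])

text \<open>
The Riccati comparison.  Adding \<open>q(n)\<close> to \<open>q1(n-1)\<close> and dividing by \<open>q2\<close> is a step of an increasing map
of the ratio \<open>q1/q2\<close>, and the error of that step is controlled by the same ratio, so an upper
bound propagates by itself.  The bound \<open>q1(n) \<le> b q2(n-1)\<close> is stated with \<open>q2(n) = q2(n-1) + q1(n)\<close> in
place of \<open>q2(n-1)\<close>.
\<close>

lemma partial_sum_ratio:
  assumes "26 \<le> n"
  shows "(1 + ratio_bound n) * q1 n \<le> ratio_bound n * q2 n"
  using assms
proof (induction n rule: dec_induct)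
  case base
  have "43/100 \<le> root4_inv 26"
  proof (rule power_le_imp_le_base[of _ 3])
    show "(43/100) ^ Suc 3 \<le> root4_inv 26 ^ Suc 3"
      using root4_inv_pow4[of 26] by (simp add: eval_nat_numeral)
  qed (use root4_inv_pos[of 26] in simp)
  then have "(43/100) ^ 2 \<le> root4_inv 26 ^ 2" "(43/100) ^ 3 \<le> root4_inv 26 ^ 3" by (intro power_mono; simp)+
  then have "(9/10) * (43/100) ^ 2 + (43/100) ^ 3 \<le> ratio_bound 26"
    unfolding ratio_bound_def using gamma_bounds by (intro add_mono mult_mono) auto
  \<comment> \<open>enough, as \<open>1069/(6287-1069) < 0.205\<close>\<close>
  then have "21/100 \<le> ratio_bound 26" by (simp add: eval_nat_numeral)
  then show ?case by (simp add: q1_q2_26 algebra_simps)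
next
  case (step m)
  define h where "h = root4_inv m"
  define b where "b = ratio_bound m"
  have h: "0 < h" "h \<le> 443/1000" using step.hyps root4_inv_pos[of m] root4_inv_le[of m] by (auto simp: h_def)
  have b: "0 < b" using step.hyps ratio_bound_pos[of m] by (simp add: b_def)
  have h4: "h^4 = 1 / real m" by (simp add: h_def root4_inv_pow4)
  \<comment> \<open>\<open>z = 1/h\<close> in \<open>q_upper\<close>, and \<open>2/5 - \<gamma>\<^sup>2 \<le> -0.42\<close>\<close>
  define k where "k = 1 / h - (42/100)"
  have k: "0 \<le> k" "h^4 * k = h^3 - (42/100) * h^4"
    using h by (auto simp: k_def field_simps eval_nat_numeral)
  have nonneg: "0 \<le> h^3 - (42/100) * h^4"
    unfolding k(2)[symmetric] using k(1) h by simp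
  have Q: "0 < q1 m" "0 < q2 m" by (rule q1_pos, rule q2_pos)
  have up: "real (Suc m) * q (Suc m) \<le> (\<gamma>^2 + h^2) * q2 m + (1 / h + 2/5 - (\<gamma>^2 + h^2)) / 2 * q1 m"
    using q_upper[of "1 / h" m] h by (simp add: gamma_sq power_divide)
  have "1 / h + 2/5 - (\<gamma>^2 + h^2) \<le> k"
    using gamma_sq_bounds zero_le_power2[of h] unfolding k_def by linarith
  then have "(\<gamma>^2 + h^2) * q2 m + (1 / h + 2/5 - (\<gamma>^2 + h^2)) / 2 * q1 m \<le> (\<gamma>^2 + h^2) * q2 m + k / 2 * q1 m"
    using Q by (intro add_left_mono mult_right_mono divide_right_mono) auto
  with up have "real (Suc m) * q (Suc m) \<le> (\<gamma>^2 + h^2) * q2 m + k / 2 * q1 m" by linarith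
  then have "h^4 * (real (Suc m) * q (Suc m)) \<le> h^4 * ((\<gamma>^2 + h^2) * q2 m + k / 2 * q1 m)"
    by (rule mult_left_mono) simp
  moreover have "1 * q (Suc m) \<le> (h^4 * real (Suc m)) * q (Suc m)"
    using h4 step.hyps q_nonneg by (intro mult_right_mono) auto
  ultimately have "q (Suc m) \<le> h^4 * ((\<gamma>^2 + h^2) * q2 m + k / 2 * q1 m)"
    by (simp only: mult_1 mult.assoc)
  also have "\<dots> = h^4 * (\<gamma>^2 + h^2) * q2 m + (h^3 - (42/100) * h^4) / 2 * q1 m"
    unfolding k(2)[symmetric] by (simp add: algebra_simps)
  finally have qS: "q (Suc m) \<le> h^4 * (\<gamma>^2 + h^2) * q2 m + (h^3 - (42/100) * h^4) / 2 * q1 m" .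
  have "(1 + b) * q1 (Suc m) \<le> (1 + (h^3 - (42/100) * h^4) / 2) * ((1 + b) * q1 m) + h^4 * (\<gamma>^2 + h^2) * (1 + b) * q2 m"
    using mult_left_mono[OF qS, of "1 + b"] b unfolding q1_Suc by (simp add: algebra_simps)
  also have "\<dots> \<le> (1 + (h^3 - (42/100) * h^4) / 2) * (b * q2 m) + h^4 * (\<gamma>^2 + h^2) * (1 + b) * q2 m"
    using step.IH nonneg by (intro add_right_mono mult_left_mono) (auto simp: b_def)
  also have "\<dots> = (b * (1 + (h^3 - (42/100) * h^4) / 2) + h^4 * (\<gamma>^2 + h^2) * (1 + b)) * q2 m"
    by (simp add: algebra_simps)
  also have "\<dots> \<le> ((\<gamma> * h^2 * (1 - h^4 / 2) + h^3 * (1 - 3 * h^4 / 4)) * (1 + b)) * q2 m"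
    using ratio_step_polynomial[OF h] Q by (intro mult_right_mono) (auto simp: b_def ratio_bound_def h_def)
  also have "\<dots> \<le> (ratio_bound (Suc m) * (1 + b)) * q2 m"
    using ratio_bound_Suc_ge[of m] step.hyps b Q by (intro mult_right_mono) (auto simp: h_def)
  finally have "(1 + b) * q1 (Suc m) \<le> (1 + b) * (ratio_bound (Suc m) * q2 m)" by (simp only: mult_ac)
  then have "q1 (Suc m) \<le> ratio_bound (Suc m) * q2 m" using b by simp
  then show ?case unfolding q2_Suc by (simp add: algebra_simps)
qed

section \<open>Consequences of the comparison\<close>

text \<open>
By \<open>partial_sum_ratio\<close> the quotient is at most \<open>b/(1+b)\<close>.  Divided by \<open>h\<^sup>2\<close> this is
\<open>(\<gamma>+h)/(1+h\<^sup>2(\<gamma>+h))\<close>, which barely exceeds \<open>1.09\<close>, its maximum being near \<open>h = 0.33\<close>.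
\<close>

lemma q1_le_q2:
  assumes "26 \<le> m" "m \<le> n"
  shows "q1 n \<le> 11/10 * root4_inv m ^ 2 * q2 n"
proof -
  define h where "h = root4_inv n"
  define b where "b = ratio_bound n"
  have h: "0 < h" "h \<le> 443/1000" using assms root4_inv_pos[of n] root4_inv_le[of n] by (auto simp: h_def)
  have b: "0 < b" using assms ratio_bound_pos[of n] by (simp add: b_def)
  \<comment> \<open>tangents of \<open>h\<^sup>3\<close> and \<open>h\<^sup>2\<close> at \<open>0.33\<close>, where the inequality is nearly sharp\<close>
  have "0 \<le> (h - 33/100)^2 * (h + 66/100)" "0 \<le> (h - 33/100)^2" using h by auto
  moreover have "(h - 33/100)^2 * (h + 66/100) = h^3 - 3267/10000 * h + 71874/1000000"
    "(h - 33/100)^2 = h^2 - 66/100 * h + 1089/10000"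
    by (simp_all add: field_simps eval_nat_numeral)
  ultimately have tangent: "3267/10000 * h - 71874/1000000 \<le> h^3" "66/100 * h - 1089/10000 \<le> h^2"
    by linarith+
  have "h * h \<le> 443/1000 * (443/1000)" using h by (intro mult_mono) auto
  then have "\<gamma> * (1 - 11/10 * h^2) \<le> 9083/10000 * (1 - 11/10 * h^2)"
    using gamma_bounds by (intro mult_right_mono) (auto simp: power2_eq_square)
  then have "\<gamma> - 11/10 * (\<gamma> * h^2) \<le> 9083/10000 - 99913/100000 * h^2" by (simp add: algebra_simps)
  then have "\<gamma> + h \<le> 11/10 + 11/10 * (\<gamma> * h^2) + 11/10 * h^3"
    using tangent h by linarith
  then have "\<gamma> + h \<le> 11/10 * (1 + \<gamma> * h^2 + h^3)" by (simp add: algebra_simps)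
  then have "h^2 * (\<gamma> + h) \<le> h^2 * (11/10 * (1 + \<gamma> * h^2 + h^3))" by (rule mult_left_mono) simp
  moreover have "h^2 * (\<gamma> + h) = b" "1 + \<gamma> * h^2 + h^3 = 1 + b"
    by (simp_all add: b_def ratio_bound_def h_def[symmetric] algebra_simps power2_eq_square power3_eq_cube)
  ultimately have "b \<le> h^2 * (11/10 * (1 + b))" by (simp only:)
  then have "b \<le> 11/10 * h^2 * (1 + b)" by (simp only: mult_ac)
  then have "b * q2 n \<le> 11/10 * h^2 * (1 + b) * q2 n"
    using q2_pos[of n] by (intro mult_right_mono) auto
  moreover have "(1 + b) * q1 n \<le> b * q2 n"
    using partial_sum_ratio[of n] assms by (simp add: b_def)
  ultimately have "(1 + b) * q1 n \<le> 11/10 * h^2 * (1 + b) * q2 n" by linarith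
  also have "\<dots> = (1 + b) * (11/10 * h^2 * q2 n)" by (simp only: mult_ac)
  finally have "(1 + b) * q1 n \<le> (1 + b) * (11/10 * h^2 * q2 n)" .
  then have "q1 n \<le> 11/10 * h^2 * q2 n" using b by simp
  also have "\<dots> \<le> 11/10 * root4_inv m ^ 2 * q2 n"
    using root4_inv_antimono[of m n] assms h q2_pos[of n]
    by (intro mult_right_mono mult_left_mono power_mono) (auto simp: h_def)
  finally show ?thesis .
qed

lemma q2_growth:
  assumes "26 \<le> m"
  shows "q2 (m + L) \<le> exp (real L * ratio_bound m) * q2 m"
proof (induction L)
  case 0 then show ?case by simp
next
  case (Suc L)
  define n where "n = m + L"
  define b where "b = ratio_bound (Suc n)"
  have "(1 + b) * q1 (Suc n) \<le> b * q2 (Suc n)"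
    using partial_sum_ratio[of "Suc n"] assms by (simp add: b_def n_def)
  then have "q1 (Suc n) \<le> b * q2 n" by (simp add: q2_Suc algebra_simps)
  also have "\<dots> \<le> ratio_bound m * q2 n"
    using ratio_bound_antimono[of m "Suc n"] assms q2_pos[of n]
    by (intro mult_right_mono) (auto simp: b_def n_def)
  finally have "q2 (Suc n) \<le> (1 + ratio_bound m) * q2 n" by (simp add: q2_Suc algebra_simps)
  also have "\<dots> \<le> exp (ratio_bound m) * q2 n"
    using q2_pos[of n] by (intro mult_right_mono exp_ge_add_one_self) auto
  also have "\<dots> \<le> exp (ratio_bound m) * (exp (real L * ratio_bound m) * q2 m)"
    using Suc by (intro mult_left_mono) (auto simp: n_def)
  finally show ?case by (simp add: n_def algebra_simps exp_add)
qed

text \<open>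
Compares the amplitude factors: the left side and the last factor on the right are the upper and lower
bounds for \<open>n q(n)/q2(n-1)\<close>, and \<open>(1+D) exp D\<close> is the relative error granted by the
thresholds.  To first order in \<open>h\<close> the quotient of the bounds is \<open>1 + 1.1h/\<gamma>\<^sup>2\<close>, about \<open>1 + 1.34h\<close>,
against \<open>1 + 3.28h\<close>.
\<close>

lemma amplitude_polynomial:
  fixes h D :: real
  assumes h: "0 < h" "h \<le> 426/1000" and D: "164/100 * h + 96/100 * h^2 \<le> D"
  shows "\<gamma>^2 + 55/100 * h + 769/1000 * h^2 \<le> (1 + D) * exp D * (\<gamma>^2 - 55/100 * h - 1674/1000 * h^2)"
proof -
  define d where "d = 164/100 * h + 96/100 * h^2"
  \<comment> \<open>rounded-down Taylor coefficients of \<open>(1+d) e^d\<close> in \<open>h\<close>\<close>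
  define T where "T = 1 + 328/100 * h + 595/100 * h^2 + 748/100 * h^3 + 712/100 * h^4"
  define E where "E = (1 + D) * exp D"
  define A where "A = 55/100 * h + 1674/1000 * h^2"
  have d: "0 < d" "d \<le> D" using h D by (auto simp: d_def intro!: add_pos_pos)
  have "1 + d / 2 + (d / 2)^2 / 2 \<le> exp (d / 2)" using d by (intro exp_lower_Taylor_quadratic) auto
  then have "(1 + d / 2 + (d / 2)^2 / 2)^2 \<le> exp (d / 2) ^ 2" using d by (intro power_mono) auto
  also have "\<dots> = exp d" by (simp add: exp_double[symmetric])
  also have "\<dots> \<le> exp D" using d by simp
  finally have "(1 + d) * (1 + d / 2 + (d / 2)^2 / 2)^2 \<le> E"
    unfolding E_def using d by (intro mult_mono) auto
  moreover have "T \<le> (1 + d) * (1 + d / 2 + (d / 2)^2 / 2)^2"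
  proof -
    have "(1 + d) * (1 + d / 2 + (d / 2)^2 / 2)^2
        = 1 + 2 * d + 3/2 * d^2 + 5/8 * d^3 + 9/64 * d^4 + d^5 / 64"
      by (simp add: field_simps eval_nat_numeral)
    moreover have "0 \<le> d^5 / 64" using d by simp
    moreover have "d = 164/100 * h + 96/100 * h^2" by (simp add: d_def)
    moreover have "d^2 = 26896/10000 * h^2 + 31488/10000 * h^3 + 9216/10000 * h^4"
      by (simp add: d_def algebra_simps eval_nat_numeral)
    moreover have "44109/10000 * h^3 + 7745/1000 * h^4 \<le> d^3"
    proof -
      have "d^3 = (164/100)^3 * h^3 + 3 * (164/100)^2 * (96/100) * h^4 + 3 * (164/100) * (96/100)^2 * h^5 + (96/100)^3 * h^6"
        by (simp add: d_def algebra_simps eval_nat_numeral)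
      moreover have "0 \<le> h^3" "0 \<le> h^4" "0 \<le> h^5" "0 \<le> h^6" using h by auto
      ultimately show ?thesis by (simp add: eval_nat_numeral)
    qed
    moreover have "72/10 * h^4 \<le> d^4"
    proof -
      have "72/10 * h^4 \<le> (164/100)^4 * h^4" by (intro mult_right_mono) (simp_all add: power_divide)
      also have "\<dots> \<le> d^4"
        unfolding power_mult_distrib[symmetric] using h by (intro power_mono) (auto simp: d_def)
      finally show ?thesis .
    qed
    moreover have "0 \<le> h^2" "0 \<le> h^3" "0 \<le> h^4" using h by auto
    ultimately show ?thesis unfolding T_def by linarith
  qed
  ultimately have TE: "T \<le> E" by linarith
  have pw: "h^2 \<le> (426/1000)^2" "h^3 \<le> (426/1000)^3" "h^4 \<le> (426/1000)^4" "0 \<le> h^2" "0 \<le> h^3" "0 \<le> h^4"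
    using h by (auto intro!: power_mono)
  have A: "0 \<le> A" "A \<le> 82/100" using h pw by (auto simp: A_def power2_eq_square)
  have "1 \<le> T" using h by (simp add: T_def)
  then have E1: "1 \<le> E" using TE by simp
  define R where "R = 632/1000 - 263/100 * h - 824/100 * h^2 - 1644/100 * h^3 - 1192/100 * h^4"
  have "- (366/100) \<le> R" unfolding R_def using h pw by (simp add: eval_nat_numeral)
  then have "h * (- (366/100)) \<le> h * R" using h by (intro mult_left_mono) auto
  then have "0 \<le> 1589/1000 + h * R" using h by linarith
  then have "0 \<le> h * (1589/1000 + h * R)" using h by simp
  also have "\<dots> \<le> (82/100 - A) * T - 82/100 - 55/100 * h - 769/1000 * h^2"
  proof -
    have "(82/100 - A) * T - 82/100 - 55/100 * h - 769/1000 * h^2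
        = h * (1589/1000 + h * R)
          + (6/10000 * h + 38/100000 * h^3 + 41/10000 * h^4 + 248/100000 * h^5 + 112/100000 * h^6)"
      unfolding A_def T_def R_def by (simp add: field_simps eval_nat_numeral)
    then show ?thesis using h by (simp add: add_nonneg_nonneg)
  qed
  also have "(82/100 - A) * T \<le> (82/100 - A) * E" using TE A by (intro mult_left_mono) auto
  finally have "0 \<le> (82/100 - A) * E - 82/100 - 55/100 * h - 769/1000 * h^2" by simp
  moreover have "82/100 * (E - 1) \<le> \<gamma>^2 * (E - 1)" using gamma_sq_bounds E1 by (intro mult_right_mono) auto
  ultimately have "\<gamma>^2 + 55/100 * h + 769/1000 * h^2 \<le> E * (\<gamma>^2 - A)"
    unfolding left_diff_distrib right_diff_distrib mult.commute[of E] mult_1 mult_1_right by linarith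
  then show ?thesis by (simp add: E_def A_def algebra_simps)
qed

lemma q_upper_q2:
  assumes "26 \<le> m" "m \<le> n" 
  defines "h \<equiv> root4_inv m"
  shows "real (Suc n) * q (Suc n) \<le> (\<gamma>^2 + 55/100 * h + 769/1000 * h^2) * q2 n"
proof -
  have h: "0 < h" "h \<le> 443/1000" using assms root4_inv_pos[of m] root4_inv_le[of m] by auto
  define k where "k = 1 / h - 42/100"
  have k: "0 \<le> k" "k * h^2 = h - 42/100 * h^2"
    using h by (auto simp: k_def field_simps eval_nat_numeral)
  have "1 / h + 2/5 - (\<gamma>^2 + h^2) \<le> k"
    using gamma_sq_bounds zero_le_power2[of h] unfolding k_def by linarith
  then have "(1 / h + 2/5 - (\<gamma>^2 + h^2)) / 2 * q1 n \<le> k / 2 * q1 n"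
    using q1_pos[of n] by (intro mult_right_mono divide_right_mono) auto
  also have "\<dots> \<le> k / 2 * (11/10 * h^2 * q2 n)"
    using q1_le_q2[of m n] assms k by (intro mult_left_mono) auto
  also have "\<dots> = 11/20 * (k * h^2) * q2 n" by simp
  finally have "(1 / h + 2/5 - (\<gamma>^2 + h^2)) / 2 * q1 n \<le> 11/20 * (h - 42/100 * h^2) * q2 n"
    unfolding k(2) .
  moreover have "real (Suc n) * q (Suc n) \<le> (\<gamma>^2 + h^2) * q2 n + (1 / h + 2/5 - (\<gamma>^2 + h^2)) / 2 * q1 n"
    using q_upper[of "1 / h" n] h by (simp add: gamma_sq power_divide)
  ultimately have "real (Suc n) * q (Suc n) \<le> (\<gamma>^2 + h^2) * q2 n + 11/20 * (h - 42/100 * h^2) * q2 n"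
    by linarith
  also have "\<dots> = (\<gamma>^2 + 55/100 * h + 769/1000 * h^2) * q2 n" by (simp add: algebra_simps)
  finally show ?thesis .
qed

lemma q_lower_q2:
  assumes "26 \<le> m"
  defines "h \<equiv> root4_inv m"
  shows "(\<gamma>^2 - 55/100 * h - 1674/1000 * h^2) * q2 m \<le> real (Suc m) * q (Suc m)"
proof -
  have h: "0 < h" "h \<le> 443/1000" using assms root4_inv_pos[of m] root4_inv_le[of m] by auto
  define k where "k = 1 / h + 1225/1000"
  have k: "0 \<le> k" "k * h^2 = h + 1225/1000 * h^2"
    using h by (auto simp: k_def field_simps eval_nat_numeral)
  have "1 / h + 2/5 + (\<gamma>^2 - h^2) \<le> k"
    using gamma_sq_bounds zero_le_power2[of h] unfolding k_def by linarith
  then have "(1 / h + 2/5 + (\<gamma>^2 - h^2)) / 2 * q1 m \<le> k / 2 * q1 m"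
    using q1_pos[of m] by (intro mult_right_mono divide_right_mono) auto
  also have "\<dots> \<le> k / 2 * (11/10 * h^2 * q2 m)"
    using q1_le_q2[of m m] assms k by (intro mult_left_mono) auto
  also have "\<dots> = 11/20 * (k * h^2) * q2 m" by simp
  finally have "(1 / h + 2/5 + (\<gamma>^2 - h^2)) / 2 * q1 m \<le> 11/20 * (h + 1225/1000 * h^2) * q2 m"
    unfolding k(2) .
  moreover have "(\<gamma>^2 - h^2) * q2 m - (1 / h + 2/5 + (\<gamma>^2 - h^2)) / 2 * q1 m \<le> real (Suc m) * q (Suc m)"
    using q_lower[of "1 / h" m] h by (simp add: gamma_sq power_divide)
  ultimately have "(\<gamma>^2 - h^2) * q2 m - 11/20 * (h + 1225/1000 * h^2) * q2 m \<le> real (Suc m) * q (Suc m)"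
    by linarith
  moreover have "11/20 * (h + 1225/1000 * h^2) = 11/20 * h + 13475/20000 * h^2" by (simp add: algebra_simps)
  then have "\<gamma>^2 - 55/100 * h - 1674/1000 * h^2 \<le> \<gamma>^2 - h^2 - 11/20 * (h + 1225/1000 * h^2)"
    using zero_le_power2[of h] by linarith
  then have "(\<gamma>^2 - 55/100 * h - 1674/1000 * h^2) * q2 m \<le> (\<gamma>^2 - h^2 - 11/20 * (h + 1225/1000 * h^2)) * q2 m"
    using q2_pos[of m] by (intro mult_right_mono) auto
  ultimately show ?thesis by (simp add: algebra_simps)
qed

section \<open>The growth of q over a shift\<close>

text \<open>
The constant that makes \<open>n > N\<^sub>B\<close> equivalent to \<open>(2+\<epsilon>) \<kappa> (n+L+1/24)^(-1/4) < \<epsilon>/B\<close>.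
\<close>

definition \<kappa> :: real where "\<kappa> = root 4 (910787328 / 10000) / pi\<^sup>2"

lemma kappa_pow4: "\<kappa> ^ 4 = 910787328 / (10000 * pi ^ 8)"
  by (simp add: \<kappa>_def power_divide power_mult[symmetric])

lemma kappa_ge: "17545/10000 \<le> \<kappa>"
proof -
  have "root 4 (910787328 / 10000) ^ 4 = (910787328 / 10000 :: real)" by (rule real_root_pow_pos2) auto
  then have "root 4 (910787328 / 10000) ^ Suc 3 = (910787328 / 10000 :: real)" by simp
  then have "(1737/100) ^ Suc 3 \<le> root 4 (910787328 / 10000 :: real) ^ Suc 3"
    by (simp only:) (simp add: eval_nat_numeral)
  then have "1737/100 \<le> root 4 (910787328 / 10000)" by (rule power_le_imp_le_base) simp
  moreover have "pi\<^sup>2 \<le> 99/10" using gamma_sq_bounds gamma_sq by simp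
  ultimately have "(1737/100) / (99/10) \<le> \<kappa>" unfolding \<kappa>_def by (intro frac_le) auto
  then show ?thesis by simp
qed

definition shift_exponent :: "nat \<Rightarrow> nat \<Rightarrow> real" where
  "shift_exponent n L = \<gamma> * real L / sqrt (real n + 1/24)"
text \<open>
The relative error of \<open>q\<close> at argument \<open>N\<close> for which the thresholds \<open>N\<^sub>A\<close> (second summand) and \<open>N\<^sub>B\<close> (first
summand) leave room.
\<close>

definition rel_slack :: "nat \<Rightarrow> real" where
  "rel_slack N = (let y = 1 / root 4 (real N + 1/24) in \<kappa> * y + y^2 / \<gamma>)"

lemma rel_slack_ge: "\<kappa> * (1 / root 4 (real N + 1/24)) \<le> rel_slack N"
  using gamma_pos by (simp add: rel_slack_def Let_def)

lemma root4_inv_shift: "(1 / root 4 (real N + 1/24)) ^ 4 = 1 / (real N + 1/24)"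
  by (simp add: power_divide)

text \<open>
With \<open>h = (n-1)^(-1/4)\<close>, \<open>q(n+L)/q(n)\<close> is at most the quotient of the amplitude bounds times
\<open>q2(n+L-1)/q2(n-1)\<close>.  The first factor is at most \<open>(1+D) e^D\<close> and the second at most \<open>e^(x+xD)\<close>, where the
correction \<open>xD\<close> absorbs the term \<open>n^(-3/4)\<close> of the supersolution.  Finally \<open>(1+x)D \<le> e^x D\<close>.
\<close>

lemma q_growth_bound:
  assumes n: "27 \<le> n" and L: "1 \<le> L" "4 * L \<le> n"
  defines "x \<equiv> shift_exponent n L" and "D \<equiv> rel_slack (n + L)"
  assumes small: "exp x * D < 1"
  shows "q (n + L) \<le> exp x * (1 + D) * exp (exp x * D) * q n"
proof -
  define m where "m = n - 1"
  have m: "26 \<le> m" "n = Suc m" using n by (auto simp: m_def)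
  define h where "h = root4_inv m"
  have h: "0 < h" "h \<le> 443/1000" using m(1) root4_inv_pos[of m] root4_inv_le[of m] by (auto simp: h_def)
  have h4: "h^4 = 1 / real m" by (simp add: h_def root4_inv_pow4)
  define y where "y = 1 / root 4 (real (n + L) + 1/24)"
  have y0: "0 < y" by (simp add: y_def)
  \<comment> \<open>since \<open>4L \<le> n\<close>, \<open>n + L + 1/24\<close> exceeds \<open>m\<close> by a factor of at most \<open>0.935^(-4)\<close>\<close>
  have "(935/1000 * h) ^ Suc 3 \<le> y ^ Suc 3"
  proof -
    have "(935/1000 :: real) ^ 4 \<le> 76427/100000" by (simp add: eval_nat_numeral)
    then have "(935/1000 :: real) ^ 4 * (1 / real m) \<le> 76427/100000 * (1 / real m)"
      by (rule mult_right_mono) simp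
    then have "(935/1000 * h) ^ 4 \<le> 76427/100000 * (1 / real m)"
      unfolding power_mult_distrib h4 .
    also have "\<dots> \<le> 1 / (real (n + L) + 1/24)"
      using L m by (simp add: divide_simps)
    also have "\<dots> = y ^ 4" by (simp only: y_def root4_inv_shift)
    finally have "(935/1000 * h) ^ 4 \<le> y ^ 4" .
    moreover have "Suc 3 = 4" by simp
    ultimately show ?thesis by (simp only:)
  qed
  then have y: "935/1000 * h \<le> y"
    by (rule power_le_imp_le_base) (use y0 in simp)
  have D: "164/100 * h + 96/100 * h^2 \<le> D"
  proof -
    have "17545/10000 * (935/1000 * h) \<le> \<kappa> * y"
      using kappa_ge y h by (intro mult_mono) auto
    moreover have "(935/1000 * h)^2 / (9083/10000) \<le> y^2 / \<gamma>"
      using y h gamma_bounds gamma_pos by (intro frac_le power_mono) auto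
    moreover have "(935/1000 * h)^2 / (9083/10000) = 874225/908300 * h^2"
      by (simp add: power2_eq_square)
    moreover have "D = \<kappa> * y + y^2 / \<gamma>" by (simp only: D_def rel_slack_def Let_def y_def)
    ultimately show ?thesis using h(1) zero_le_power2[of h] by linarith
  qed
  have D0: "0 < D" using D h(1) zero_le_power2[of h] by linarith
  define g where "g = 1 / sqrt (real n + 1/24)"
  have g: "h^2 * (1 - h / 10) \<le> g"
  proof -
    have "h^2 * (1 - h / 10) * sqrt (real n + 1/24) \<le> 1"
    proof (rule power2_le_imp_le)
      have "h * h * h \<le> 443/1000 * (443/1000) * (443/1000)" using h by (intro mult_mono) auto
      then have "h * (h * h * h) \<le> h * (443/1000 * (443/1000) * (443/1000))" using h by (intro mult_left_mono) auto
      then have a: "1 + 25/24 * h^4 \<le> 1 + 91/1000 * h" using h by (simp add: eval_nat_numeral)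
      have "h * h \<le> 443/1000 * h" using h by (intro mult_right_mono) auto
      moreover have "(1 - h / 10)^2 = 1 - h / 5 + h * h / 100" by (simp add: power2_eq_square field_simps)
      ultimately have b: "(1 - h / 10)^2 \<le> 1 - 195/1000 * h" using h by linarith
      have "(1 - h / 10)^2 * (1 + 25/24 * h^4) \<le> (1 - 195/1000 * h) * (1 + 91/1000 * h)"
        using a b h by (intro mult_mono) auto
      also have "\<dots> \<le> 1" using h by (simp add: algebra_simps)
      finally have "(1 - h / 10)^2 * (1 + 25/24 * h^4) \<le> 1" .
      moreover have "1 + 25/24 * h^4 = h^4 * (real n + 1/24)" using m h4 by (simp add: field_simps)
      ultimately show "(h^2 * (1 - h / 10) * sqrt (real n + 1/24))^2 \<le> 1^2"
        by (simp add: power_mult_distrib power_mult[symmetric] mult_ac)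
    qed simp
    then show ?thesis by (simp add: g_def pos_le_divide_eq)
  qed
  have g0: "0 < g" using n by (simp add: g_def)
  have x: "x = \<gamma> * real L * g" by (simp add: x_def shift_exponent_def g_def)
  have x0: "0 \<le> x" using x gamma_pos g0 by simp
  \<comment> \<open>\<open>e^x D < 1\<close> with \<open>L \<ge> 1\<close> excludes the largest values of \<open>h\<close>, where the amplitude comparison would fail\<close>
  have h': "h \<le> 426/1000"
  proof (rule ccontr)
    assume "\<not> h \<le> 426/1000"
    then have hl: "426/1000 \<le> h" by simp
    have "9055/10000 * 1 * ((426/1000)^2 * (1 - 443/10000)) \<le> \<gamma> * real L * (h^2 * (1 - h / 10))"
      using gamma_bounds L hl h by (intro mult_mono power_mono) auto
    also have "\<dots> \<le> x" unfolding x using g gamma_pos by (intro mult_left_mono) auto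
    finally have "157/1000 \<le> x" by (simp add: eval_nat_numeral)
    then have "1157/1000 \<le> exp x" using exp_ge_add_one_self[of x] by linarith
    moreover have "(426/1000)^2 \<le> h^2" using hl by (intro power_mono) auto
    then have "8728/10000 \<le> D" using D hl by (simp add: power2_eq_square)
    ultimately have "(1157/1000) * (8728/10000) \<le> exp x * D" by (intro mult_mono) auto
    then show False using small by simp
  qed
  have Lb: "real L * ratio_bound m \<le> x * (1 + D)"
  proof -
    have "h * h \<le> 443/1000 * h" using h by (intro mult_right_mono) auto
    then have w: "146/100 * h \<le> 154/100 * h - 164/1000 * h^2" unfolding power2_eq_square using h by linarith
    have "9055/10000 * (146/100 * h) \<le> \<gamma> * (154/100 * h - 164/1000 * h^2)"
      by (rule mult_mono[OF gamma_bounds(1) w]) (use h gamma_pos in simp_all)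
    moreover have "\<gamma> * ((1 - h / 10) * (1 + 164/100 * h)) = \<gamma> + \<gamma> * (154/100 * h - 164/1000 * h^2)"
      by (simp add: field_simps power2_eq_square)
    ultimately have "\<gamma> + h \<le> \<gamma> * ((1 - h / 10) * (1 + 164/100 * h))"
      using h by linarith
    then have "h^2 * (\<gamma> + h) \<le> h^2 * (\<gamma> * ((1 - h / 10) * (1 + 164/100 * h)))"
      by (rule mult_left_mono) simp
    also have "\<dots> = \<gamma> * ((h^2 * (1 - h / 10)) * (1 + 164/100 * h))" by (simp only: mult_ac)
    also have "\<dots> \<le> \<gamma> * (g * (1 + D))"
    proof (rule mult_left_mono)
      have "1 + 164/100 * h \<le> 1 + D" using D zero_le_power2[of h] by linarith
      then show "h^2 * (1 - h / 10) * (1 + 164/100 * h) \<le> g * (1 + D)"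
        by (rule mult_mono[OF g]) (use g0 h in simp_all)
    qed (use gamma_pos in simp)
    finally have "ratio_bound m \<le> \<gamma> * (g * (1 + D))"
      by (simp add: ratio_bound_def h_def[symmetric] algebra_simps power2_eq_square power3_eq_cube)
    then have "real L * ratio_bound m \<le> real L * (\<gamma> * (g * (1 + D)))" by (rule mult_left_mono) simp
    then show ?thesis by (simp add: x mult_ac)
  qed
  let ?up = "\<gamma>^2 + 55/100 * h + 769/1000 * h^2"
  let ?low = "\<gamma>^2 - 55/100 * h - 1674/1000 * h^2"
  have "real n * q (n + L) \<le> real (n + L) * q (n + L)"
    using q_nonneg by (intro mult_right_mono) auto
  also have "\<dots> \<le> ?up * q2 (m + L)"
    using q_upper_q2[of m "m + L"] m by (simp add: h_def)
  also have "\<dots> \<le> ?up * (exp (x * (1 + D)) * q2 m)"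
  proof (rule mult_left_mono)
    have "q2 (m + L) \<le> exp (real L * ratio_bound m) * q2 m" by (rule q2_growth[OF m(1)])
    also have "\<dots> \<le> exp (x * (1 + D)) * q2 m" using Lb q2_pos[of m] by (intro mult_right_mono) auto
    finally show "q2 (m + L) \<le> exp (x * (1 + D)) * q2 m" .
  qed (use h in auto)
  also have "\<dots> \<le> ((1 + D) * exp D * ?low) * (exp (x * (1 + D)) * q2 m)"
    using amplitude_polynomial[OF h(1) h' D] q2_pos[of m] by (intro mult_right_mono) auto
  also have "\<dots> = ((1 + D) * exp D * exp (x * (1 + D))) * (?low * q2 m)" by (simp only: mult_ac)
  also have "\<dots> \<le> ((1 + D) * exp D * exp (x * (1 + D))) * (real n * q n)"
    using q_lower_q2[OF m(1)] D0 m by (intro mult_left_mono) (auto simp: h_def)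
  also have "\<dots> = exp x * (1 + D) * exp ((1 + x) * D) * (real n * q n)"
    by (simp add: algebra_simps exp_add)
  also have "\<dots> \<le> exp x * (1 + D) * exp (exp x * D) * (real n * q n)"
  proof (rule mult_right_mono)
    have "(1 + x) * D \<le> exp x * D" using D0 by (intro mult_right_mono exp_ge_add_one_self) auto
    then show "exp x * (1 + D) * exp ((1 + x) * D) \<le> exp x * (1 + D) * exp (exp x * D)"
      using D0 by (intro mult_left_mono) auto
  qed (simp add: q_nonneg)
  also have "\<dots> = real n * (exp x * (1 + D) * exp (exp x * D) * q n)" by simp
  finally show ?thesis using n by simp
qed

text \<open>
For \<open>L > n/4\<close> the exponent \<open>x\<close> is at least of order \<open>\<surd>L\<close>, so already \<open>1 + x\<close> outgrows \<open>(n+L)^(1/4)\<close> and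
\<open>e^x D < 1\<close> fails.  All quantities are compared through their fourth powers.
\<close>

lemma shift_le_quarter:
  assumes n: "1 \<le> n" and L: "1 \<le> L"
    and small: "exp (shift_exponent n L) * rel_slack (n + L) < 1"
  shows "4 * L \<le> n"
proof (rule ccontr)
  assume "\<not> 4 * L \<le> n"
  then have nL: "real n + 1/24 \<le> 4 * real L" "real (n + L) + 1/24 \<le> 5 * real L" by linarith+
  define x where "x = shift_exponent n L"
  define y where "y = 1 / root 4 (real (n + L) + 1/24)"
  have y: "0 < y" "y^4 = 1 / (real (n + L) + 1/24)" by (simp_all only: y_def root4_inv_shift) simp
  have x2: "x^2 = \<gamma>^2 * (real L)^2 / (real n + 1/24)"
    by (simp add: x_def shift_exponent_def power_divide power_mult_distrib)
  have "\<gamma>^2 * real L / 4 = \<gamma>^2 * (real L)^2 / (4 * real L)" using L by (simp add: power2_eq_square)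
  also have "\<dots> \<le> x^2" unfolding x2 using nL by (intro divide_left_mono) auto
  finally have "\<gamma>^2 * real L / 4 \<le> x^2" .
  then have xL: "82/100 * real L \<le> 4 * x^2" using gamma_sq_bounds(1) mult_right_mono[of "82/100" "\<gamma>^2" "real L"] by simp
  have "((1 + x) * \<kappa> * y) ^ 4 < 1"
  proof -
    have "(1 + x) * \<kappa> * y \<le> exp x * rel_slack (n + L)"
      using rel_slack_ge[of "n + L"] kappa_ge y exp_ge_add_one_self[of x]
      unfolding mult.assoc by (intro mult_mono) (auto simp: y_def)
    then have "(1 + x) * \<kappa> * y < 1" using small by (simp add: x_def)
    moreover have "0 \<le> (1 + x) * \<kappa> * y"
      using kappa_ge y gamma_pos by (auto simp: x_def shift_exponent_def intro!: mult_nonneg_nonneg add_nonneg_nonneg)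
    ultimately show ?thesis by (simp add: power_less_one_iff)
  qed
  moreover have "1 \<le> ((1 + x) * \<kappa> * y) ^ 4"
  proof -
    have "4 * x \<le> (1 + x)^2" using zero_le_power2[of "1 - x"] by (simp add: power2_eq_square algebra_simps)
    then have "(4 * x)^2 \<le> ((1 + x)^2)^2" using gamma_pos by (intro power_mono) (auto simp: x_def shift_exponent_def)
    then have a: "32/10 * real L \<le> (1 + x) ^ 4" using xL by (simp add: power_mult_distrib power_mult[symmetric])
    have b: "2 \<le> \<kappa> ^ 4" using power_mono[OF kappa_ge, of 4] by (simp add: eval_nat_numeral)
    have "1 / (5 * real L) \<le> y ^ 4" unfolding y(2) using nL by (intro divide_left_mono) auto
    then have "32/10 * real L * 2 * (1 / (5 * real L)) \<le> (1 + x) ^ 4 * \<kappa> ^ 4 * y ^ 4"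
      using a b by (intro mult_mono) auto
    then show ?thesis using L by (simp add: power_mult_distrib)
  qed
  ultimately show False by simp
qed

section \<open>Matching the thresholds\<close>

text \<open>
The three inequalities \<open>n > N\<^sub>A\<close>, \<open>n > N\<^sub>B\<close>, \<open>n > N\<^sub>D\<close> are rewritten in terms of \<open>x\<close> and \<open>D\<close>; their
combination is \<open>e^x (1 + (2+\<epsilon>)D) < 1+\<epsilon>\<close>, which rearranges to \<open>e^x (1+D) < (1+\<epsilon>)(1 - e^x D)\<close>.
\<close>

lemma threshold_consequences:
  assumes pos: "0 < A" "0 < B" "0 < C" "1/A + 1/B + 1/C < 1" "0 < \<epsilon>"
    and n: "N_ABC A B C \<epsilon> L < real n"
  defines "x \<equiv> shift_exponent n L" and "D \<equiv> rel_slack (n + L)"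
  shows "27 \<le> n" and "exp x * D < 1" and "exp x * (1 + D) * exp (exp x * D) \<le> 1 + \<epsilon>"
proof -
  have NA: "N_A A \<epsilon> L < real n" and NB: "N_B B \<epsilon> L < real n"
    and ND: "N_D (1/A + 1/B + 1/C) \<epsilon> L < real n" and "26 < real n"
    using n unfolding N_ABC_def by auto
  then show "27 \<le> n" by linarith
  define y where "y = 1 / root 4 (real (n + L) + 1/24)"
  have y: "0 < y" "real (n + L) + 1/24 = 1 / y^4" by (simp_all add: y_def power_divide)
  have a: "(2 + \<epsilon>) * (y^2 / \<gamma>) < \<epsilon> / A"
  proof -
    have "(A * (2 + \<epsilon>) / (\<gamma> * \<epsilon>))^2 = 12 * A^2 * (2 + \<epsilon>)^2 / (pi\<^sup>2 * \<epsilon>^2)"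
      by (simp add: power_divide power_mult_distrib gamma_sq)
    also have "\<dots> < 1 / y^4" using NA unfolding N_A_def y(2)[symmetric] by simp
    also have "\<dots> = (1 / y^2)^2" by (simp add: power_divide)
    finally have "A * (2 + \<epsilon>) / (\<gamma> * \<epsilon>) < 1 / y^2" by (rule power2_less_imp_less) simp
    then show ?thesis using pos gamma_pos y by (simp add: field_simps)
  qed
  have b: "(2 + \<epsilon>) * (\<kappa> * y) < \<epsilon> / B"
  proof -
    have "(\<kappa> * B * (2 + \<epsilon>) / \<epsilon>)^4 = 910787328 * B^4 * (2 + \<epsilon>)^4 / (10000 * pi^8 * \<epsilon>^4)"
      by (simp add: power_divide power_mult_distrib kappa_pow4 mult_ac)
    also have "\<dots> < 1 / y^4" using NB unfolding N_B_def y(2)[symmetric] by simp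
    also have "\<dots> = (1 / y)^4" by (simp add: power_divide)
    finally have "\<kappa> * B * (2 + \<epsilon>) / \<epsilon> < 1 / y" by (rule power_less_imp_less_base) (use y in simp)
    then show ?thesis using pos y by (simp add: field_simps)
  qed
  define s where "s = 1/A + 1/B + 1/C"
  have s: "0 < s" "s < 1" using pos by (auto simp: s_def intro!: add_pos_pos)
  have Ds: "(2 + \<epsilon>) * D < \<epsilon> * s"
  proof -
    have "0 < \<epsilon> / C" using pos by simp
    then show ?thesis using a b by (simp add: D_def rel_slack_def Let_def y_def s_def algebra_simps)
  qed
  define w where "w = (1 + \<epsilon>) / (1 + \<epsilon> * s)"
  have es: "0 < \<epsilon> * s" "\<epsilon> * s < \<epsilon>" using pos s by auto
  then have w: "1 < w" using pos by (simp add: w_def)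
  then have lw: "0 < ln w" by simp
  have "(\<gamma> * real L / ln w)^2 = (real L)^2 * pi\<^sup>2 / (12 * (ln w)^2)"
    by (simp add: power_divide power_mult_distrib gamma_sq)
  also have "\<dots> < real n + 1/24" using ND unfolding N_D_def w_def s_def by simp
  finally have "\<gamma> * real L / ln w < sqrt (real n + 1/24)" by (rule real_less_rsqrt)
  then have "x < ln w" using lw by (simp add: x_def shift_exponent_def field_simps)
  then have "exp x < exp (ln w)" by simp
  then have "exp x < w" using w by simp
  then have "exp x * (1 + \<epsilon> * s) < 1 + \<epsilon>" using es by (simp add: w_def pos_less_divide_eq)
  moreover have "exp x * (1 + (2 + \<epsilon>) * D) \<le> exp x * (1 + \<epsilon> * s)" using Ds by simp
  ultimately have key: "exp x * (1 + D) < (1 + \<epsilon>) * (1 - exp x * D)" by (simp add: algebra_simps)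
  have "0 < \<kappa> * y" using kappa_ge y by simp
  then have "0 < D" using rel_slack_ge[of "n + L"] by (simp add: D_def y_def)
  then have "0 < exp x * (1 + D)" by simp
  then have "0 < (1 + \<epsilon>) * (1 - exp x * D)" using key by linarith
  then show t: "exp x * D < 1" using pos by (simp add: zero_less_mult_iff)
  define t where "t = exp x * D"
  have "exp x * (1 + D) * exp t \<le> (1 + \<epsilon>) * (1 - t) * exp t"
    using key by (intro mult_right_mono) (auto simp: t_def)
  also have "\<dots> \<le> (1 + \<epsilon>) * exp (- t) * exp t"
    using exp_ge_add_one_self[of "- t"] pos by (intro mult_right_mono mult_left_mono) auto
  also have "\<dots> = 1 + \<epsilon>" by (simp add: exp_minus)
  finally show "exp x * (1 + D) * exp (exp x * D) \<le> 1 + \<epsilon>" by (simp add: t_def)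
qed

text \<open>
For \<open>L = 0\<close> the claim about \<open>q\<close> is trivial and \<open>m = 1\<close>.  Otherwise \<open>4L \<le> n\<close>, which also guarantees \<open>m \<le> n\<close> through
\<open>m - 1 \<le> m(m-1)/2 \<le> L\<close>, as the passage from \<open>1\<close> to the least part \<open>m\<close> requires.
\<close>

theorem rho_shift_le:
  assumes "0 < A" "0 < B" "0 < C" "1/A + 1/B + 1/C < 1" "0 < \<epsilon>" "1 \<le> m"
    and n: "N_ABC A B C \<epsilon> (\<mu> + m * (m - 1) div 2) < real n"
  shows "real (rho (n + \<mu>) m) \<le> (1 + \<epsilon>) * real (rho n m)"
proof -
  define L where "L = \<mu> + m * (m - 1) div 2"
  note T = threshold_consequences[OF assms(1-5) n, folded L_def]
  have "m \<le> n \<and> q (n + L) \<le> (1 + \<epsilon>) * q n"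
  proof (cases "L = 0")
    case True
    then have "m * (m - 1) div 2 = 0" by (simp add: L_def)
    then have "m = 1" using assms(6) by (cases "m - 1") auto
    then show ?thesis using True T(1) assms(5) q_nonneg[of n] by (simp add: algebra_simps)
  next
    case False
    then have L: "1 \<le> L" "4 * L \<le> n" using shift_le_quarter[of n L] T by auto
    have "2 * (m - 1) \<le> m * (m - 1)"
      using assms(6) by (cases "m = 1") auto
    then have "m - 1 \<le> m * (m - 1) div 2" by linarith
    then have "m - 1 \<le> L" by (simp add: L_def)
    then have "m \<le> n" using L by linarith
    moreover have "q (n + L) \<le> exp (shift_exponent n L) * (1 + rel_slack (n + L)) * exp (exp (shift_exponent n L) * rel_slack (n + L)) * q n"
      using T L by (intro q_growth_bound) auto
    moreover have "\<dots> \<le> (1 + \<epsilon>) * q n" using T(3) q_nonneg by (intro mult_right_mono) auto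
    ultimately show ?thesis by linarith
  qed
  then have "m \<le> n" and "real (rho (n + (\<mu> + m * (m - 1) div 2)) 1) \<le> (1 + \<epsilon>) * real (rho n 1)"
    by (simp_all only: q_def L_def)
  then show ?thesis
    by (rule growth_bound_all_min_parts[OF assms(6) _ less_imp_le[OF assms(5)]])
qed

theorem corollary2p7:
  fixes r s :: nat and \<alpha> \<beta> :: "nat \<Rightarrow> real" and \<mu>r m :: nat
  assumes "1 \<le> r" and "1 \<le> s" and "1 \<le> m"
    and "\<forall>k\<in>{1..r}. 0 < \<alpha> k" and "\<forall>l\<in>{1..s}. 0 < \<beta> l"
    and "(\<Sum>k=1..r. \<alpha> k) < (\<Sum>l=1..s. \<beta> l)"
  shows "(\<exists>N::real. \<forall>\<mu> \<nu> :: nat \<Rightarrow> nat.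
             strict_mono_on {1..r} \<mu> \<and> \<mu> r = \<mu>r \<and> strict_mono_on {1..s} \<nu> \<longrightarrow>
             (\<forall>n::nat. N < real n \<longrightarrow>
               (\<Sum>k=1..r. \<alpha> k * real (rho (n + \<mu> k) m)) \<le> (\<Sum>l=1..s. \<beta> l * real (rho (n + \<nu> l) m))))
       \<and> (\<forall>A B C :: real. 0 < A \<and> 0 < B \<and> 0 < C \<and> 1/A + 1/B + 1/C < 1 \<longrightarrow>
           (let L = \<mu>r + m * (m - 1) div 2;
                \<epsilon> = inverse (\<Sum>k=1..r. \<alpha> k) * ((\<Sum>l=1..s. \<beta> l) - (\<Sum>k=1..r. \<alpha> k))
            in \<forall>\<mu> \<nu> :: nat \<Rightarrow> nat.
             strict_mono_on {1..r} \<mu> \<and> \<mu> r = \<mu>r \<and> strict_mono_on {1..s} \<nu> \<longrightarrow>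
             (\<forall>n::nat. N_ABC A B C \<epsilon> L < real n \<longrightarrow>
               (\<Sum>k=1..r. \<alpha> k * real (rho (n + \<mu> k) m)) \<le> (\<Sum>l=1..s. \<beta> l * real (rho (n + \<nu> l) m)))))"
proof -
  define a where "a = (\<Sum>k=1..r. \<alpha> k)"
  define b where "b = (\<Sum>l=1..s. \<beta> l)"
  define \<epsilon> where "\<epsilon> = inverse a * (b - a)"
  define L where "L = \<mu>r + m * (m - 1) div 2"
  have a: "0 < a" unfolding a_def using assms(1,4) by (intro sum_pos) auto
  have "a < b" unfolding a_def b_def by (rule assms(6))
  then have eps: "0 < \<epsilon>" "(1 + \<epsilon>) * a = b"
    using a by (auto simp: \<epsilon>_def field_simps)
  have main: "(\<Sum>k=1..r. \<alpha> k * real (rho (n + \<mu> k) m)) \<le> (\<Sum>l=1..s. \<beta> l * real (rho (n + \<nu> l) m))"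
    if ABC: "0 < A" "0 < B" "0 < C" "1/A + 1/B + 1/C < 1"
      and \<mu>: "strict_mono_on {1..r} \<mu>" "\<mu> r = \<mu>r"
      and n: "N_ABC A B C \<epsilon> L < real n" for A B C \<mu> \<nu> n
  proof -
    have n1: "1 \<le> n" using threshold_consequences(1)[OF ABC eps(1) n] by simp
    have "(\<Sum>k=1..r. \<alpha> k * real (rho (n + \<mu> k) m)) \<le> (\<Sum>k=1..r. \<alpha> k * real (rho (n + \<mu>r) m))"
    proof (intro sum_mono mult_left_mono)
      fix k assume k: "k \<in> {1..r}"
      have "\<mu> k \<le> \<mu> r" using strict_mono_on_leD[OF \<mu>(1), of k r] k assms(1) by auto
      then show "real (rho (n + \<mu> k) m) \<le> real (rho (n + \<mu>r) m)"
        using n1 \<mu>(2) by (simp add: rho_mono)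
      show "0 \<le> \<alpha> k" using assms(4) k by (auto intro: less_imp_le)
    qed
    also have "\<dots> = a * real (rho (n + \<mu>r) m)" by (simp add: a_def sum_distrib_right)
    also have "\<dots> \<le> a * ((1 + \<epsilon>) * real (rho n m))"
      using rho_shift_le[OF ABC eps(1) assms(3), of \<mu>r n] n a by (intro mult_left_mono) (auto simp: L_def)
    also have "\<dots> = (\<Sum>l=1..s. \<beta> l * real (rho n m))"
      using eps(2) by (simp add: b_def mult_ac flip: sum_distrib_right)
    also have "\<dots> \<le> (\<Sum>l=1..s. \<beta> l * real (rho (n + \<nu> l) m))"
      using assms(5) n1 by (intro sum_mono mult_left_mono) (auto simp: rho_mono less_imp_le)
    finally show ?thesis .
  qed
  show ?thesis
    unfolding Let_def a_def[symmetric] b_def[symmetric] \<epsilon>_def[symmetric] L_def[symmetric]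
  proof (intro conjI allI impI)
    show "\<exists>N::real. \<forall>\<mu> \<nu> :: nat \<Rightarrow> nat.
             strict_mono_on {1..r} \<mu> \<and> \<mu> r = \<mu>r \<and> strict_mono_on {1..s} \<nu> \<longrightarrow>
             (\<forall>n::nat. N < real n \<longrightarrow>
               (\<Sum>k=1..r. \<alpha> k * real (rho (n + \<mu> k) m)) \<le> (\<Sum>l=1..s. \<beta> l * real (rho (n + \<nu> l) m)))"
      by (rule exI[of _ "N_ABC 4 4 4 \<epsilon> L"], intro allI impI, rule main[of 4 4 4]) simp_all
  next
    fix A B C :: real and \<mu> \<nu> :: "nat \<Rightarrow> nat" and n :: nat
    assume "0 < A \<and> 0 < B \<and> 0 < C \<and> 1/A + 1/B + 1/C < 1"
      and "strict_mono_on {1..r} \<mu> \<and> \<mu> r = \<mu>r \<and> strict_mono_on {1..s} \<nu>"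
      and n: "N_ABC A B C \<epsilon> L < real n"
    then show "(\<Sum>k=1..r. \<alpha> k * real (rho (n + \<mu> k) m)) \<le> (\<Sum>l=1..s. \<beta> l * real (rho (n + \<nu> l) m))"
      by (intro main[OF _ _ _ _ _ _ n]) simp_all
  qed
qed

end
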